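(* There exists a Borel map $\Theta:\mathrm{SB}\to \mathcal{K}(B_{\ell_\infty})$ such that, for each $X\in \mathrm{SB}$, $B_{X^*}\equiv \Theta(X)$, where the isometry between $B_{X^*}$ and $\Theta(X)$ is the restriction of a linear isometry between $X^*$ and $\overline{\mathrm{span}}\{\Theta(X)\}$. Moreover, setting $$\mathbb{A}=\{(X,x,x^* )\in \mathrm{SB}\times C(\Delta)\times B_{\ell_\infty}\mid x\in X,\ x^*\in \Theta(X)\},$$ there exists a Borel map $\langle\cdot,\cdot\rangle_{(\cdot)}:\mathbb{A}\to \mathbb{R}$, $(X,x,x^* )\mapsto\langle x^*,x\rangle_X$, such that, for each $X\in \mathrm{SB}$, (i) $\langle \cdot,\cdot\rangle_X$ is norm continuous, and (ii) $x^*\in \Theta(X)\mapsto \langle x^*,\cdot\rangle_X\in B_{X^*}$ is a surjective isometry.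
   Context: $\Delta=2^{\mathbb{N}}$ is the Cantor set and $C(\Delta)$ is the Banach space of (real-valued) continuous functions on $\Delta$ with the supremum norm. $\mathrm{SB}=\{X\subset C(\Delta)\mid X\text{ is a closed linear subspace}\}$, endowed with the Effros-Borel structure, i.e. the $\sigma$-algebra generated by the sets $\{X\in \mathrm{SB}\mid X\cap U\neq\emptyset\}$, $U\subset C(\Delta)$ open; this is a standard Borel space. $B_E$ denotes the closed unit ball of a Banach space $E$. As a topological space, $B_{\ell_\infty}$ (the unit ball of $\ell_\infty=\ell_1^*$) carries the weak$^*$ topology, so it is a compact metrizable space; Borel subsets of $B_{\ell_\infty}$ and compact subsets of $B_{\ell_\infty}$ refer to this topology. $\mathcal{K}(M)$ is the space of all compact subsets of $M$ with the Vietoris topology. $A\equiv B$ means that $A$ and $B$ are isometric; isometry, norm continuity and closed linear span here refer to the norms: the dual norm of $X^*$ on $B_{X^*}$, the norm $\|\cdot\|_\infty$ on $\Theta(X)\subset \ell_\infty$, and the norm of $X$. *)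

theory Defs
  imports "HOL-Analysis.Analysis"
begin

definition borel_of :: "'a topology \<Rightarrow> 'a measure"
  where "borel_of T = sigma (topspace T) {U. openin T U}"

definition vietoris :: "'a topology \<Rightarrow> 'a set topology"
  where "vietoris T = topology_generated_by
    ({{K. compactin T K \<and> K \<subseteq> U} | U. openin T U} \<union>
     {{K. compactin T K \<and> K \<inter> U \<noteq> {}} | U. openin T U})"

text \<open>\<open>nat \<Rightarrow> bool\<close> carries the product of the discrete topologies, so it is the Cantor set.
  As it is compact, its continuous real functions are exactly the bounded continuous ones, and
  the norm of \<open>\<Rightarrow>\<^sub>C\<close> is the supremum norm.\<close>

type_synonym c_cantor = "(nat \<Rightarrow> bool) \<Rightarrow>\<^sub>C real"

definition SB :: "c_cantor set set"
  where "SB = {X. subspace X \<and> closed X}"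

definition effros_borel :: "c_cantor set measure"
  where "effros_borel = sigma SB {{X \<in> SB. X \<inter> U \<noteq> {}} | U. open U}"

text \<open>\<open>nat\<close> is discrete, so \<open>nat \<Rightarrow>\<^sub>C real\<close> is the space of all bounded sequences.\<close>

type_synonym l_infty = "nat \<Rightarrow>\<^sub>C real"

text \<open>The coarsest topology making the pairing with every absolutely summable sequence \<open>a\<close> continuous.\<close>

definition weak_star :: "l_infty topology"
  where "weak_star = topology_generated_by
    {{x. (\<Sum>n. a n * apply_bcontfun x n) \<in> V} | (a :: nat \<Rightarrow> real) V.
      summable (\<lambda>n. \<bar>a n\<bar>) \<and> open V}"

definition ball_l_infty :: "l_infty topology"
  where "ball_l_infty = subtopology weak_star (cball 0 1)"

text \<open>A functional on a subspace \<open>X\<close> is represented by its extension by \<open>0\<close> outside \<open>X\<close> (in general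
  not linear on the whole space), so that distinct representatives differ on \<open>X\<close> and the
  operations of the dual are pointwise.\<close>

definition dual :: "'a::real_normed_vector set \<Rightarrow> ('a \<Rightarrow> real) set"
  where "dual X = {f. (\<forall>x\<in>X. \<forall>y\<in>X. f (x + y) = f x + f y) \<and>
    (\<forall>c. \<forall>x\<in>X. f (c *\<^sub>R x) = c * f x) \<and>
    (\<exists>C. \<forall>x\<in>X. \<bar>f x\<bar> \<le> C * norm x) \<and>
    (\<forall>x. x \<notin> X \<longrightarrow> f x = 0)}"

definition dual_norm :: "'a::real_normed_vector set \<Rightarrow> ('a \<Rightarrow> real) \<Rightarrow> real"
  where "dual_norm X f = (SUP x\<in>{x \<in> X. norm x \<le> 1}. \<bar>f x\<bar>)"

definition dual_ball :: "'a::real_normed_vector set \<Rightarrow> ('a \<Rightarrow> real) set"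
  where "dual_ball X = {f \<in> dual X. dual_norm X f \<le> 1}"

definition dual_linear_isometry ::
  "(('a::real_normed_vector \<Rightarrow> real) \<Rightarrow> 'b::real_normed_vector) \<Rightarrow> 'a set \<Rightarrow> 'b set \<Rightarrow> bool"
  where "dual_linear_isometry T X Y \<longleftrightarrow>
    (\<forall>f\<in>dual X. \<forall>g\<in>dual X. T (\<lambda>x. f x + g x) = T f + T g) \<and>
    (\<forall>c. \<forall>f\<in>dual X. T (\<lambda>x. c * f x) = c *\<^sub>R T f) \<and>
    (\<forall>f\<in>dual X. norm (T f) = dual_norm X f) \<and>
    T ` dual X = Y"

definition isometry_onto_dual_ball ::
  "('b::real_normed_vector \<Rightarrow> 'a::real_normed_vector \<Rightarrow> real) \<Rightarrow> 'b set \<Rightarrow> 'a set \<Rightarrow> bool"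
  where "isometry_onto_dual_ball F K X \<longleftrightarrow>
    F ` K = dual_ball X \<and>
    (\<forall>u\<in>K. \<forall>v\<in>K. dual_norm X (\<lambda>x. F u x - F v x) = dist u v)"

definition pairing_domain ::
  "(c_cantor set \<Rightarrow> l_infty set) \<Rightarrow> (c_cantor set \<times> c_cantor \<times> l_infty) set"
  where "pairing_domain \<Theta> =
    {(X, x, u). X \<in> SB \<and> u \<in> cball 0 1 \<and> x \<in> X \<and> u \<in> \<Theta> X}"

text \<open>The Borel structure of a subset of a product is the trace of the product one.\<close>

definition pairing_borel ::
  "(c_cantor set \<Rightarrow> l_infty set) \<Rightarrow> (c_cantor set \<times> c_cantor \<times> l_infty) measure"
  where "pairing_borel \<Theta> =
    restrict_space (effros_borel \<Otimes>\<^sub>M borel \<Otimes>\<^sub>M borel_of ball_l_infty) (pairing_domain \<Theta>)"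

end

theory Submission
  imports Defs
begin

text \<open>By the Kuratowski--Ryll-Nardzewski selection argument there are Borel maps \<open>d\<^sub>n\<close> on \<open>SB\<close> such that
  the vectors \<open>d\<^sub>n X\<close> are dense in \<open>X\<close>. A functional \<open>f\<close> on \<open>X\<close> is sent to the sequence of the numbers
  \<open>f (d\<^sub>n X) / max 1 \<parallel>d\<^sub>n X\<parallel>\<close>; this is a linear isometry into the bounded sequences, and \<open>\<Theta> X\<close> is the
  image of the dual ball. Membership in \<open>\<Theta> X\<close> amounts to countably many weak-star closed conditions
  depending measurably on \<open>X\<close>, so by compactness \<open>\<Theta> X\<close> meets a closed set \<open>C\<close> iff for every \<open>k\<close> some
  point of a fixed countable dense subset of \<open>C\<close> satisfies the first \<open>k\<close> conditions up to \<open>1/k\<close>; this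
  makes \<open>\<Theta>\<close> Borel. The pairing at \<open>x\<close> is recovered as a limit along vectors \<open>d\<^sub>n X\<close> approaching \<open>x\<close>,
  with indices chosen measurably.\<close>

section \<open>Continuous functions on the Cantor set\<close>

text \<open>Truncations are eventually \<open>False\<close>, hence countably many in all, and they
  serve as canonical representatives of the cylinders of length \<open>n\<close>.\<close>

definition truncate_at :: "nat \<Rightarrow> (nat \<Rightarrow> bool) \<Rightarrow> nat \<Rightarrow> bool"
  where "truncate_at n t = (\<lambda>i. i < n \<and> t i)"

lemma open_agree: "open {s :: nat \<Rightarrow> bool. \<forall>i<n. s i = t i}"
  using product_topology_basis'[of "{..<n}" "\<lambda>i. {t i}" "\<lambda>i. i"] by (simp add: open_discrete Ball_def)

lemma open_imp_agree_subset:
  fixes U :: "(nat \<Rightarrow> bool) set"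
  assumes "open U" "t \<in> U"
  obtains n where "{s. \<forall>i<n. s i = t i} \<subseteq> U"
proof -
  obtain X where X: "t \<in> Pi\<^sub>E UNIV X" "finite {i. X i \<noteq> UNIV}" "Pi\<^sub>E UNIV X \<subseteq> U"
    using product_topology_open_contains_basis[of "\<lambda>_. euclidean" UNIV U t] assms
    by (auto simp: open_fun_def)
  obtain n where n: "\<And>i. X i \<noteq> UNIV \<Longrightarrow> i < n"
    using X(2) unfolding finite_nat_set_iff_bounded by auto
  have "{s. \<forall>i<n. s i = t i} \<subseteq> Pi\<^sub>E UNIV X"
    using n X(1) by (force simp: PiE_iff)
  with X(3) show ?thesis by (intro that) blast
qed

lemma compact_cantor: "compact (UNIV :: (nat \<Rightarrow> bool) set)"
  using compactin_PiE[of "\<lambda>_. euclidean :: bool topology" "UNIV :: nat set" "\<lambda>_. UNIV"]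
  by (simp add: euclidean_product_topology finite_imp_compact)

text \<open>By compactness finitely many cylinders, on each of which \<open>f\<close> stays within
  \<open>e/2\<close> of its value at the centre, cover the Cantor set. With \<open>n\<close> at
  least all their lengths, two points agreeing below \<open>n\<close> fall into a common
  one.\<close>

lemma cantor_uniformly_continuous:
  fixes f :: "(nat \<Rightarrow> bool) \<Rightarrow> 'b::metric_space"
  assumes f: "continuous_on UNIV f" and e: "e > 0"
  obtains n where "\<And>s t. \<forall>i<n. s i = t i \<Longrightarrow> dist (f s) (f t) < e"
proof -
  have "\<exists>n. {s. \<forall>i<n. s i = t i} \<subseteq> f -` ball (f t) (e/2)" for t
    by (rule open_imp_agree_subset[of "f -` ball (f t) (e/2)" t])
      (use f e in \<open>auto simp: continuous_on_open_vimage\<close>)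
  from choice[OF allI[OF this]] obtain N
    where N: "\<forall>t. {s. \<forall>i<N t. s i = t i} \<subseteq> f -` ball (f t) (e/2)" ..
  obtain F where F: "finite F" "UNIV \<subseteq> (\<Union>t\<in>F. {s. \<forall>i<N t. s i = t i})"
    by (rule compactE_image[OF compact_cantor, of UNIV "\<lambda>t. {s. \<forall>i<N t. s i = t i}"])
      (auto intro: open_agree)
  obtain n where n: "\<And>t. t \<in> F \<Longrightarrow> N t \<le> n"
    using finite_imageI[OF F(1), of N] by (auto simp: finite_nat_set_iff_bounded_le)
  show thesis
  proof
    fix s s' :: "nat \<Rightarrow> bool" assume eq: "\<forall>i<n. s i = s' i"
    obtain t where t: "t \<in> F" "\<forall>i<N t. s i = t i" using F(2) by blast
    with eq n[OF t(1)] have "\<forall>i<N t. s' i = t i" by (metis order_less_le_trans)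
    with t have "s \<in> f -` ball (f t) (e/2)" "s' \<in> f -` ball (f t) (e/2)"
      by (blast intro: subsetD[OF N[rule_format]])+
    then have "dist (f t) (f s) < e/2" "dist (f t) (f s') < e/2" by simp_all
    then show "dist (f s) (f s') < e" by (metis dist_commute dist_triangle_half_r)
  qed
qed

text \<open>Rational-valued functions of finitely many coordinates are coded by a countable type,
  and uniform continuity makes them dense.\<close>

lemma ex_dense_sequence_c_cantor: "\<exists>y :: nat \<Rightarrow> c_cantor. closure (range y) = UNIV"
proof -
  \<comment> \<open>A code is a word length with a finite table of values on words. Words missing
    from the table get 0, so that every code yields a function.\<close>
  define h where "h = (\<lambda>(n, L :: (bool list \<times> rat) list) (t :: nat \<Rightarrow> bool).
    case map_of L (map t [0..<n]) of None \<Rightarrow> 0 | Some q \<Rightarrow> real_of_rat q)"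
  have h: "h p \<in> bcontfun" for p
  proof -
    obtain n L where p: "p = (n, L)" by (cases p)
    have loc: "h p s = h p t" if "\<forall>i<n. s i = t i" for s t
    proof -
      have "map s [0..<n] = map t [0..<n]" using that by simp
      then show ?thesis by (simp only: h_def p prod.case)
    qed
    have cont: "continuous_on UNIV (h p)"
      unfolding continuous_on_open_vimage[OF open_UNIV]
    proof (intro allI impI, subst open_subopen, intro ballI)
      fix U t assume "open U" "t \<in> h p -` U \<inter> UNIV"
      then show "\<exists>S. open S \<and> t \<in> S \<and> S \<subseteq> h p -` U \<inter> UNIV"
        by (intro exI[of _ "{s. \<forall>i<n. s i = t i}"]) (use loc open_agree in \<open>auto\<close>)
    qed
    \<comment> \<open>Each value is an entry of the table, so the sum of the absolute values of all
      entries bounds \<open>h p\<close>.\<close>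
    have "map_of L l = Some q \<Longrightarrow> \<bar>real_of_rat q\<bar> \<le> (\<Sum>(l, q)\<leftarrow>L. \<bar>real_of_rat q\<bar>)" for l q
      by (rule member_le_sum_list) (force dest: map_of_SomeD)+
    moreover have "0 \<le> (\<Sum>(l, q)\<leftarrow>L. \<bar>real_of_rat q\<bar>)"
      by (rule sum_list_nonneg) auto
    ultimately have "norm (h p t) \<le> (\<Sum>(l, q)\<leftarrow>L. \<bar>real_of_rat q\<bar>)" for t
      by (auto simp: h_def p split: option.split)
    with cont show ?thesis by (rule bcontfun_normI)
  qed
  define y where "y k = Bcontfun (h (from_nat k))" for k
  have y: "apply_bcontfun (y k) = h (from_nat k)" for k
    by (simp add: y_def Bcontfun_inverse h)
  have "f \<in> closure (range y)" for f :: c_cantor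
    unfolding closure_approachable
  proof (intro allI impI)
    fix e :: real assume e: "0 < e"
    obtain n where n: "\<And>s t. \<forall>i<n. s i = t i \<Longrightarrow> dist (f s) (f t) < e/3"
      by (rule cantor_uniformly_continuous[of "apply_bcontfun f" "e/3"]) (use e in auto)
    have "\<exists>q. \<bar>real_of_rat q - r\<bar> < e/3" for r
    proof -
      obtain q where "r - e/3 < real_of_rat q" "real_of_rat q < r + e/3"
        using of_rat_dense[of "r - e/3" "r + e/3"] e by auto
      then show ?thesis by (intro exI[of _ q]) linarith
    qed
    then obtain Q where Q: "\<And>r. \<bar>real_of_rat (Q r) - r\<bar> < e/3" by metis
    \<comment> \<open>The table lists every word of length \<open>n\<close>, with a rational value
      close to \<open>f\<close> at the word continued by \<open>False\<close>. The error below is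
      \<open>e/3\<close> for rounding plus \<open>e/3\<close> for truncation.\<close>
    define L where "L = map (\<lambda>l. (l, Q (f (\<lambda>i. i < n \<and> l ! i)))) (List.n_lists n [True, False])"
    have "\<bar>h (n, L) t - f t\<bar> \<le> 2 * e / 3" for t
    proof -
      have "map t [0..<n] \<in> set (List.n_lists n [True, False])"
        by (auto simp: set_n_lists)
      then have "map_of L (map t [0..<n]) = Some (Q (f (\<lambda>i. i < n \<and> map t [0..<n] ! i)))"
        by (simp add: L_def map_of_map_restrict)
      also have "(\<lambda>i. i < n \<and> map t [0..<n] ! i) = truncate_at n t"
        by (auto simp: truncate_at_def fun_eq_iff)
      finally have "h (n, L) t = real_of_rat (Q (f (truncate_at n t)))" by (simp add: h_def)
      moreover have "dist (f (truncate_at n t)) (f t) < e/3" by (rule n) (simp add: truncate_at_def)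
      ultimately show ?thesis
        using Q[of "f (truncate_at n t)"] unfolding dist_real_def by linarith
    qed
    then have "dist (y (to_nat (n, L))) f \<le> 2 * e / 3"
      by (intro dist_bound) (simp add: y dist_real_def)
    with e show "\<exists>g\<in>range y. dist g f < e" by (intro bexI[of _ "y (to_nat (n, L))"]) auto
  qed
  then show ?thesis by blast
qed

text \<open>The type \<open>c_cantor\<close> is not an instance of \<open>second_countable_topology\<close>, so measurability of norms
  of sums is derived from evaluations at countably many points.\<close>

lemma norm_c_cantor_le_iff:
  fixes z :: c_cantor
  shows "norm z \<le> r \<longleftrightarrow> (\<forall>l :: bool list. \<bar>z (\<lambda>i. i < length l \<and> l ! i)\<bar> \<le> r)"
proof
  assume "norm z \<le> r"
  then show "\<forall>l :: bool list. \<bar>z (\<lambda>i. i < length l \<and> l ! i)\<bar> \<le> r"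
    using norm_bounded[of z] by (metis order_trans real_norm_def)
next
  assume *: "\<forall>l :: bool list. \<bar>z (\<lambda>i. i < length l \<and> l ! i)\<bar> \<le> r"
  show "norm z \<le> r"
  proof (rule norm_bound)
    fix t
    have "\<bar>z t\<bar> \<le> r + e" if e: "e > 0" for e
    proof -
      obtain n where n: "\<And>s t. \<forall>i<n. s i = t i \<Longrightarrow> dist (z s) (z t) < e"
        by (rule cantor_uniformly_continuous[of "apply_bcontfun z" e]) (use e in auto)
      have "(\<lambda>i. i < length (map t [0..<n]) \<and> map t [0..<n] ! i) = truncate_at n t"
        by (auto simp: truncate_at_def fun_eq_iff)
      then have "\<bar>z (truncate_at n t)\<bar> \<le> r" using * by metis
      moreover have "dist (z (truncate_at n t)) (z t) < e" by (rule n) (simp add: truncate_at_def)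
      ultimately show ?thesis unfolding dist_real_def by linarith
    qed
    then have "\<bar>z t\<bar> \<le> r" by (rule field_le_epsilon)
    then show "norm (z t) \<le> r" by simp
  qed
qed

lemma borel_measurable_norm_c_cantor:
  fixes f :: "'m \<Rightarrow> c_cantor"
  assumes [measurable]: "\<And>t. (\<lambda>w. apply_bcontfun (f w) t) \<in> borel_measurable M"
  shows "(\<lambda>w. norm (f w)) \<in> borel_measurable M"
  unfolding borel_measurable_iff_le norm_c_cantor_le_iff by (intro allI) measurable

text \<open>A Cauchy sequence in the supremum distance is uniformly Cauchy, and a uniform limit of
  bounded continuous functions is again one; the domain may be any topological space.\<close>

lemma complete_bcontfun: "complete (UNIV :: ('a::topological_space \<Rightarrow>\<^sub>C 'b::complete_space) set)"
  unfolding complete_def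
proof (intro allI impI, elim conjE)
  fix f :: "nat \<Rightarrow> 'a \<Rightarrow>\<^sub>C 'b" assume "Cauchy f"
  then obtain g where "uniform_limit UNIV f g sequentially"
    using uniformly_convergent_eq_cauchy[of "\<lambda>_. True" f]
    unfolding Cauchy_def uniform_limit_sequentially_iff
    by (metis dist_fun_lt_imp_dist_val_lt)
  from uniform_limit_bcontfunE[OF this sequentially_bot]
  show "\<exists>l\<in>UNIV. f \<longlonglongrightarrow> l" by (metis UNIV_I)
qed

lemma continuous_on_eval_bcontfun: "continuous_on UNIV (\<lambda>f. apply_bcontfun f t)"
  unfolding continuous_on_iff using dist_fun_lt_imp_dist_val_lt by blast

section \<open>Measurable selections and the Vietoris topology\<close>

text \<open>For each pair \<open>(i, j)\<close> a chain of balls with centres from \<open>y\<close>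
  and radii \<open>r j k\<close> is followed, each meeting \<open>F w\<close> and consecutive ones
  meeting inside \<open>F w\<close>; the centres converge to a point of the closed set
  \<open>F w\<close>. Starting at \<open>y i\<close> whenever its ball meets \<open>F w\<close>
  makes these limits dense.\<close>

lemma Castaing_representation:
  fixes F :: "'m \<Rightarrow> 'a::metric_space set" and y :: "nat \<Rightarrow> 'a"
  assumes complete: "complete (UNIV :: 'a set)" and dense: "closure (range y) = UNIV"
    and closed: "\<And>w. w \<in> space M \<Longrightarrow> closed (F w)"
    and nonempty: "\<And>w. w \<in> space M \<Longrightarrow> F w \<noteq> {}"
    and hit: "\<And>U. open U \<Longrightarrow> {w \<in> space M. F w \<inter> U \<noteq> {}} \<in> sets M"
  obtains d :: "nat \<Rightarrow> 'm \<Rightarrow> 'a"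
  where "\<And>n. d n \<in> borel_measurable M"
    and "\<And>w. w \<in> space M \<Longrightarrow> closure (range (\<lambda>n. d n w)) = F w"
proof -
  have near: "\<exists>m. x \<in> ball (y m) e" if "e > 0" for x e
    using dense that closure_approachable[of x "range y"] by auto
  define r where "r j k = (1/2 :: real) ^ (j + k)" for j k :: nat
  have r_pos: "r j k > 0" for j k by (simp add: r_def)
  \<comment> \<open>If the prescribed ball misses \<open>F w\<close>, the first ball that meets it
    is taken instead, so that the selection is defined for every \<open>w\<close>.\<close>
  define st where "st i j w = (if F w \<inter> ball (y i) (r j 0) \<noteq> {} then i
    else LEAST m. F w \<inter> ball (y m) (r j 0) \<noteq> {})" for i j w
  \<comment> \<open>Taking the least admissible index keeps the choice measurable in
    \<open>w\<close>, since it is decided by countably many hitting events.\<close>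
  define step where "step j w m k =
    (LEAST m'. F w \<inter> (ball (y m) (r j k) \<inter> ball (y m') (r j (Suc k))) \<noteq> {})" for j w m k
  define a where "a i j w = rec_nat (st i j w) (\<lambda>k m. step j w m k)" for i j w
  have a0: "a i j w 0 = st i j w" and aS: "a i j w (Suc k) = step j w (a i j w k) k" for i j w k
    by (simp_all add: a_def)
  have a_hit: "F w \<inter> ball (y (a i j w k)) (r j k) \<noteq> {}" if w: "w \<in> space M" for i j w k
  proof (induction k)
    case 0
    obtain x where "x \<in> F w" using nonempty[OF w] by auto
    with near[OF r_pos[of j 0], of x] have "\<exists>m. F w \<inter> ball (y m) (r j 0) \<noteq> {}" by blast
    then have "F w \<inter> ball (y (LEAST m. F w \<inter> ball (y m) (r j 0) \<noteq> {})) (r j 0) \<noteq> {}"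
      by (rule LeastI_ex)
    then show ?case by (simp add: a0 st_def)
  next
    case (Suc k)
    then obtain x where x: "x \<in> F w \<inter> ball (y (a i j w k)) (r j k)" by blast
    with near[OF r_pos[of j "Suc k"], of x]
    have "\<exists>m'. F w \<inter> (ball (y (a i j w k)) (r j k) \<inter> ball (y m') (r j (Suc k))) \<noteq> {}" by blast
    then have "F w \<inter> (ball (y (a i j w k)) (r j k) \<inter> ball (y (a i j w (Suc k))) (r j (Suc k))) \<noteq> {}"
      unfolding aS step_def by (rule LeastI_ex)
    then show ?case by auto
  qed
  have a_step: "dist (y (a i j w k)) (y (a i j w (Suc k))) \<le> 2 * r j k"
    if w: "w \<in> space M" for i j w k
  proof -
    obtain x where x: "x \<in> F w \<inter> ball (y (a i j w k)) (r j k)" using a_hit[OF w] by blast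
    with near[OF r_pos[of j "Suc k"], of x]
    have "\<exists>m'. F w \<inter> (ball (y (a i j w k)) (r j k) \<inter> ball (y m') (r j (Suc k))) \<noteq> {}" by blast
    then have "F w \<inter> (ball (y (a i j w k)) (r j k) \<inter> ball (y (a i j w (Suc k))) (r j (Suc k))) \<noteq> {}"
      unfolding aS step_def by (rule LeastI_ex)
    then obtain z where "dist (y (a i j w k)) z < r j k" "dist (y (a i j w (Suc k))) z < r j (Suc k)"
      by auto
    moreover have "r j (Suc k) \<le> r j k" by (simp add: r_def)
    ultimately show ?thesis
      using dist_triangle2[of "y (a i j w k)" "y (a i j w (Suc k))" z] by linarith
  qed
  have a_dist: "dist (y (a i j w k)) (y (a i j w (k + n))) \<le> 4 * r j k" if w: "w \<in> space M" for i j w k n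
  proof -
    \<comment> \<open>Subtracting \<open>4 * r j (k + n)\<close> strengthens the bound enough for
      induction: as radii halve, each step releases exactly the \<open>2 * r j (k + n)\<close>
      allowed by \<open>a_step\<close>.\<close>
    have "dist (y (a i j w k)) (y (a i j w (k + n))) \<le> 4 * r j k - 4 * r j (k + n)"
    proof (induction n)
      case (Suc n)
      have "4 * r j (k + n) - 4 * r j (k + Suc n) = 2 * r j (k + n)" by (simp add: r_def)
      with Suc a_step[OF w, of i j "k + n"]
      show ?case using dist_triangle[of "y (a i j w k)" "y (a i j w (k + Suc n))" "y (a i j w (k + n))"]
        by simp
    qed simp
    with r_pos[of j "k + n"] show ?thesis by linarith
  qed
  have r_lim: "(\<lambda>k. c * r j k) \<longlonglongrightarrow> 0" for c j
    unfolding r_def power_add by (auto intro!: tendsto_eq_intros LIMSEQ_power_zero)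
  define D where "D i j w = lim (\<lambda>k. y (a i j w k))" for i j w
  have lim_D: "(\<lambda>k. y (a i j w k)) \<longlonglongrightarrow> D i j w" if w: "w \<in> space M" for i j w
  proof -
    have "Cauchy (\<lambda>k. y (a i j w k))"
      unfolding Cauchy_altdef2
    proof (intro allI impI)
      fix e :: real assume "e > 0"
      then obtain k where k: "4 * r j k < e"
        using order_tendstoD(2)[OF r_lim[of 4 j], of e] unfolding eventually_sequentially by auto
      show "\<exists>N. \<forall>n\<ge>N. dist (y (a i j w n)) (y (a i j w N)) < e"
      proof (intro exI allI impI)
        fix n assume "n \<ge> k"
        then obtain p where "n = k + p" using le_Suc_ex by blast
        with a_dist[OF w, of i j k p] k show "dist (y (a i j w n)) (y (a i j w k)) < e"
          by (simp add: dist_commute)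
      qed
    qed
    then have "convergent (\<lambda>k. y (a i j w k))"
      using complete unfolding complete_def convergent_def by blast
    then show ?thesis unfolding D_def by (simp add: convergent_LIMSEQ_iff)
  qed
  have D_in: "D i j w \<in> F w" if w: "w \<in> space M" for i j w
  proof -
    obtain x where x: "\<And>k. x k \<in> F w" "\<And>k. dist (y (a i j w k)) (x k) < r j k"
      using a_hit[OF w, of i j] by (auto simp: disjoint_iff) metis
    have "(\<lambda>k. dist (y (a i j w k)) (x k)) \<longlonglongrightarrow> 0"
      by (rule real_tendsto_sandwich[OF _ _ tendsto_const r_lim[of 1 j]])
        (simp_all add: less_imp_le[OF x(2)])
    from tendsto_add[OF this tendsto_dist_iff[THEN iffD1, OF lim_D[OF w, of i j]]]
    have "(\<lambda>k. dist (y (a i j w k)) (x k) + dist (y (a i j w k)) (D i j w)) \<longlonglongrightarrow> 0"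
      by simp
    then have "(\<lambda>k. dist (x k) (D i j w)) \<longlonglongrightarrow> 0"
      by (rule real_tendsto_sandwich[OF _ _ tendsto_const, rotated 2]) (simp_all add: dist_triangle3)
    then have "x \<longlonglongrightarrow> D i j w"
      by (rule tendsto_dist_iff[THEN iffD2])
    then show ?thesis by (rule closed_sequentially[OF closed[OF w] x(1)])
  qed
  have D_near: "dist (y i) (D i j w) \<le> 4 * r j 0"
    if w: "w \<in> space M" and i: "F w \<inter> ball (y i) (r j 0) \<noteq> {}" for i j w
  proof (rule LIMSEQ_le_const2)
    show "(\<lambda>k. dist (y i) (y (a i j w k))) \<longlonglongrightarrow> dist (y i) (D i j w)"
      by (intro tendsto_intros lim_D w)
    show "\<exists>N. \<forall>n\<ge>N. dist (y i) (y (a i j w n)) \<le> 4 * r j 0"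
      using a_dist[OF w, of i j 0] i by (auto simp: a0 st_def)
  qed
  have D_dense: "x \<in> closure (range (\<lambda>n. D (fst (prod_decode n)) (snd (prod_decode n)) w))"
    if w: "w \<in> space M" and x: "x \<in> F w" for w x
    unfolding closure_approachable
  proof (intro allI impI)
    fix e :: real assume "e > 0"
    \<comment> \<open>The factor 5 is 4 radii from the selected point to the centre
      \<open>y i\<close> and one from the centre to \<open>x\<close>.\<close>
    then obtain j where j: "5 * r 0 j < e"
      using order_tendstoD(2)[OF r_lim[of 5 0], of e] unfolding eventually_sequentially by auto
    obtain i where i: "x \<in> ball (y i) (r j 0)" using near[OF r_pos] by blast
    have "dist (y i) (D i j w) \<le> 4 * r j 0" using D_near[OF w, of i j] x i by blast
    moreover have "r j 0 = r 0 j" by (simp add: r_def)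
    ultimately have "dist (D i j w) x < e"
      using i j dist_triangle3[of "D i j w" x "y i"] by simp
    then show "\<exists>v\<in>range (\<lambda>n. D (fst (prod_decode n)) (snd (prod_decode n)) w). dist v x < e"
      by (intro bexI[of _ "D i j w"]) (auto intro!: image_eqI[of _ _ "prod_encode (i, j)"])
  qed
  have hit_pred: "Measurable.pred M (\<lambda>w. F w \<inter> U \<noteq> {})" if "open U" for U
    using hit[OF that] by (simp add: pred_def)
  have [measurable]: "st i j \<in> measurable M (count_space UNIV)" for i j
    unfolding st_def[abs_def]
    by (intro measurable_If measurable_Least measurable_const hit_pred[unfolded pred_def]
        hit_pred open_ball) simp_all
  have step: "(\<lambda>w. step j w m k) \<in> measurable M (count_space UNIV)" for j m k
    unfolding step_def by (intro measurable_Least hit_pred open_Int open_ball)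
  \<comment> \<open>The previous index takes countably many values, so substituting it into
    \<open>step\<close> preserves measurability.\<close>
  have a_meas: "(\<lambda>w. a i j w k) \<in> measurable M (count_space UNIV)" for i j k
  proof (induction k)
    case (Suc k)
    then show ?case unfolding aS
      using measurable_compose_countable[of "\<lambda>m w. step j w m k", OF step Suc] by simp
  qed (simp add: a0)
  have D_meas: "D i j \<in> borel_measurable M" for i j
    by (rule borel_measurable_LIMSEQ_metric[OF _ lim_D])
      (rule measurable_compose[OF a_meas], auto)
  show thesis
  proof (rule that)
    show "D (fst (prod_decode n)) (snd (prod_decode n)) \<in> borel_measurable M" for n
      by (rule D_meas)
    fix w assume w: "w \<in> space M"
    show "closure (range (\<lambda>n. D (fst (prod_decode n)) (snd (prod_decode n)) w)) = F w"
      by (intro antisym closure_minimal subsetI D_dense w closed) (use D_in[OF w] in auto)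
  qed
qed

section \<open>Borel sets of a topology and of its Vietoris hyperspace\<close>

lemma space_borel_of: "space (borel_of T) = topspace T"
  by (simp add: borel_of_def space_measure_of_conv)

lemma measurable_borel_ofI:
  assumes "\<And>w. w \<in> space M \<Longrightarrow> f w \<in> topspace T"
    and "\<And>U. openin T U \<Longrightarrow> {w \<in> space M. f w \<in> U} \<in> sets M"
  shows "f \<in> M \<rightarrow>\<^sub>M borel_of T"
  unfolding borel_of_def
proof (rule measurable_measure_of)
  fix U assume "U \<in> {U. openin T U}"
  moreover have "f -` U \<inter> space M = {w \<in> space M. f w \<in> U}" by auto
  ultimately show "f -` U \<inter> space M \<in> sets M" using assms(2) by simp
qed (use assms(1) openin_subset in auto)

lemma measurable_borel_of_continuous_map:
  assumes "continuous_map T euclidean f"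
  shows "f \<in> borel_of T \<rightarrow>\<^sub>M borel"
proof (rule borel_measurableI)
  fix S :: "'b set" assume "open S"
  then have "openin T {x \<in> topspace T. f x \<in> S}"
    using assms by (simp add: continuous_map_def)
  moreover have "f -` S \<inter> space (borel_of T) = {x \<in> topspace T. f x \<in> S}"
    by (auto simp: space_borel_of)
  moreover have "{U. openin T U} \<subseteq> Pow (topspace T)" using openin_subset by auto
  ultimately show "f -` S \<inter> space (borel_of T) \<in> sets (borel_of T)"
    by (simp add: borel_of_def)
qed

lemma topspace_vietoris: "topspace (vietoris T) = {K. compactin T K}"
proof
  show "topspace (vietoris T) \<subseteq> {K. compactin T K}"
    unfolding vietoris_def topology_generated_by_topspace by auto
  have "{K. compactin T K} = {K. compactin T K \<and> K \<subseteq> topspace T}"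
    by (auto dest: compactin_subset_topspace)
  then show "{K. compactin T K} \<subseteq> topspace (vietoris T)"
    unfolding vietoris_def topology_generated_by_topspace
    by (intro Union_upper UnI1 CollectI exI[of _ "topspace T"]) simp
qed

text \<open>A compact set inside an open \<open>U\<close> already lies in a finite union of base
  sets contained in \<open>U\<close>, so a countable base of \<open>T\<close> gives a countable
  subbase of the Vietoris topology. Meeting an open set reduces to meeting closed ones, as open sets
  are F-sigma in a metrizable space, and lying inside an open set means missing its closed
  complement.\<close>

lemma measurable_vietoris:
  assumes T: "second_countable T" "metrizable_space T"
    and compact: "\<And>w. w \<in> space M \<Longrightarrow> compactin T (F w)"
    and hit: "\<And>C. closedin T C \<Longrightarrow> {w \<in> space M. F w \<inter> C \<noteq> {}} \<in> sets M"
  shows "F \<in> M \<rightarrow>\<^sub>M borel_of (vietoris T)"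
proof (rule measurable_borel_ofI)
  show "F w \<in> topspace (vietoris T)" if "w \<in> space M" for w
    by (simp add: topspace_vietoris compact that)
next
  fix W assume "openin (vietoris T) W"
  then have W: "generate_topology_on
    ({{K. compactin T K \<and> K \<subseteq> U} | U. openin T U} \<union>
     {{K. compactin T K \<and> K \<inter> U \<noteq> {}} | U. openin T U}) W"
    by (simp add: vietoris_def openin_topology_generated_by)
  obtain B where B: "countable B" "\<And>V. V \<in> B \<Longrightarrow> openin T V"
    and base: "\<And>U x. openin T U \<Longrightarrow> x \<in> U \<Longrightarrow> \<exists>V\<in>B. x \<in> V \<and> V \<subseteq> U"
    using T(1) unfolding second_countable_def by metis
  define S where "S = (\<lambda>U. {K. compactin T K \<and> K \<inter> U \<noteq> {}}) ` B \<union>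
    (\<lambda>\<U>. {K. compactin T K \<and> K \<subseteq> \<Union>\<U>}) ` {\<U>. finite \<U> \<and> \<U> \<subseteq> B}"
  have "countable S"
    unfolding S_def using B(1) by (intro countable_Un countable_image countable_Collect_finite_subset)
  \<comment> \<open>Finite subfamilies of \<open>S\<close> whose common compact members all lie in
    \<open>W\<close>; by \<open>nbhd\<close> these countably many basic sets exhaust
    \<open>W\<close>.\<close>
  define \<G> where "\<G> = {G. finite G \<and> G \<subseteq> S \<and> {K. compactin T K} \<inter> \<Inter>G \<subseteq> W}"
  have "countable \<G>"
    by (rule countable_subset[OF _ countable_Collect_finite_subset[OF \<open>countable S\<close>]])
      (auto simp: \<G>_def)
  have nbhd: "\<exists>G. finite G \<and> G \<subseteq> S \<and> K \<in> \<Inter>G \<and> {K. compactin T K} \<inter> \<Inter>G \<subseteq> W"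
    if "K \<in> W" "compactin T K" for K
    using W that
  proof (induction rule: generate_topology_on.induct)
    case (Int a b)
    then obtain G H where "finite G" "G \<subseteq> S" "K \<in> \<Inter>G" "{K. compactin T K} \<inter> \<Inter>G \<subseteq> a"
      "finite H" "H \<subseteq> S" "K \<in> \<Inter>H" "{K. compactin T K} \<inter> \<Inter>H \<subseteq> b" by auto
    then show ?case by (intro exI[of _ "G \<union> H"]) auto
  next
    case (UN \<K>)
    then obtain k where "k \<in> \<K>" "K \<in> k" by blast
    from UN.IH[OF this \<open>compactin T K\<close>] obtain G where G: "finite G \<and> G \<subseteq> S \<and> K \<in> \<Inter>G"
      "{K. compactin T K} \<inter> \<Inter>G \<subseteq> k" by (elim exE conjE) (rule that; simp)
    from G(2) Union_upper[OF \<open>k \<in> \<K>\<close>] have "{K. compactin T K} \<inter> \<Inter>G \<subseteq> \<Union>\<K>"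
      by (rule order_trans)
    with G(1) show ?case by (intro exI[of _ G]) simp
  next
    case (Basis s)
    from Basis.hyps show ?case
    proof (elim UnE CollectE exE conjE)
      fix U assume 1: "s = {K. compactin T K \<and> K \<subseteq> U}" "openin T U"
      define C where "C = {V \<in> B. V \<subseteq> U}"
      have "K \<subseteq> U" using Basis 1 by simp
      then have "K \<subseteq> \<Union>C" using base[OF 1(2)] unfolding C_def by (simp add: subset_iff) metis
      moreover have "\<forall>V\<in>C. openin T V" using B(2) by (simp add: C_def)
      ultimately obtain \<U> where "finite \<U>" "\<U> \<subseteq> C" "K \<subseteq> \<Union>\<U>"
        using \<open>compactin T K\<close> unfolding compactin_def by meson
      moreover from this have "\<Union>\<U> \<subseteq> U" "\<U> \<subseteq> B" by (auto simp: C_def)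
      ultimately show ?case
        unfolding 1(1) using \<open>compactin T K\<close>
        by (intro exI[of _ "{{K. compactin T K \<and> K \<subseteq> \<Union>\<U>}}"] conjI)
          (simp_all add: S_def le_infI2 order_trans[of _ "\<Union>\<U>" U] Collect_mono)
    next
      fix U assume 2: "s = {K. compactin T K \<and> K \<inter> U \<noteq> {}}" "openin T U"
      then have "K \<inter> U \<noteq> {}" using Basis by simp
      then obtain x where "x \<in> K" "x \<in> U" by blast
      from base[OF 2(2) this(2)] obtain V where "V \<in> B" "x \<in> V" "V \<subseteq> U" by blast
      then show ?case
        unfolding 2(1) using \<open>compactin T K\<close> \<open>x \<in> K\<close>
        by (intro exI[of _ "{{K. compactin T K \<and> K \<inter> V \<noteq> {}}}"] conjI)
          (simp, simp add: S_def, blast, blast)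
    qed
  qed simp
  have S_meas: "{w \<in> space M. F w \<in> s} \<in> sets M" if "s \<in> S" for s
  proof -
    from that[unfolded S_def] show ?thesis
    proof (elim UnE imageE CollectE conjE)
      fix U assume s: "s = {K. compactin T K \<and> K \<inter> U \<noteq> {}}" and U: "U \<in> B"
      obtain \<C> where \<C>: "countable \<C>" "\<And>C. C \<in> \<C> \<Longrightarrow> closedin T C" "\<Union>\<C> = U"
        using open_imp_fsigma_in[OF T(2) B(2)[OF U]]
        by (auto simp: fsigma_in_def union_of_def)
      have "{w \<in> space M. F w \<in> s} = (\<Union>C\<in>\<C>. {w \<in> space M. F w \<inter> C \<noteq> {}})"
        using \<C>(3) compact by (auto simp: s)
      then show ?thesis using \<C> hit by (auto intro: sets.countable_UN')
    next
      fix \<U> assume s: "s = {K. compactin T K \<and> K \<subseteq> \<Union>\<U>}" and \<U>: "\<U> \<subseteq> B"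
      have "openin T (\<Union>\<U>)" using \<U> B(2) by blast
      then have "closedin T (topspace T - \<Union>\<U>)" by blast
      moreover have "{w \<in> space M. F w \<in> s} =
        space M - {w \<in> space M. F w \<inter> (topspace T - \<Union>\<U>) \<noteq> {}}"
        using compact compactin_subset_topspace by (fastforce simp: s)
      ultimately show ?thesis using hit by auto
    qed
  qed
  have "{w \<in> space M. F w \<in> W} = (\<Union>G\<in>\<G>. {w \<in> space M. \<forall>s\<in>G. F w \<in> s})"
  proof (intro equalityI subsetI)
    fix w assume w: "w \<in> {w \<in> space M. F w \<in> W}"
    with nbhd[of "F w"] compact
    obtain G where "finite G" "G \<subseteq> S" "F w \<in> \<Inter>G" "{K. compactin T K} \<inter> \<Inter>G \<subseteq> W" by auto
    with w show "w \<in> (\<Union>G\<in>\<G>. {w \<in> space M. \<forall>s\<in>G. F w \<in> s})" by (auto simp: \<G>_def)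
  qed (use compact in \<open>auto simp: \<G>_def\<close>)
  also have "\<dots> \<in> sets M"
    by (intro sets.countable_UN' \<open>countable \<G>\<close> image_subsetI sets.sets_Collect_countable_All' S_meas)
      (auto simp: \<G>_def intro: countable_finite)
  finally show "{w \<in> space M. F w \<in> W} \<in> sets M" .
qed

text \<open>The quantifier over the possibly uncountable \<open>C\<close> becomes one over a
  countable dense \<open>D\<close>. Finitely many strict inequalities survive a small move of an
  exact solution into \<open>D\<close>, which is what the slack \<open>1 / Suc k\<close> allows.
  Conversely, approximate solutions for all \<open>k\<close> accumulate at a point of
  \<open>C\<close>, where the slack has vanished.\<close>

lemma sets_ex_compact_all_nonpos:
  fixes C :: "'b::{metric_space, second_countable_topology} set" and g :: "nat \<Rightarrow> 'm \<Rightarrow> 'b \<Rightarrow> real"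
  assumes C: "compact C"
    and cont: "\<And>j w. w \<in> space M \<Longrightarrow> continuous_on C (g j w)"
    and meas: "\<And>j u. u \<in> C \<Longrightarrow> (\<lambda>w. g j w u) \<in> borel_measurable M"
  shows "{w \<in> space M. \<exists>u\<in>C. \<forall>j. g j w u \<le> 0} \<in> sets M"
proof -
  obtain D where D: "countable D" "D \<subseteq> C" "C \<subseteq> closure D"
    using separable[of C] by blast
  have "{w \<in> space M. \<exists>u\<in>C. \<forall>j. g j w u \<le> 0} =
    {w \<in> space M. \<forall>k. \<exists>u\<in>D. \<forall>j\<le>k. g j w u < 1 / Suc k}"
  proof (intro Collect_cong conj_cong refl iffI allI)
    fix w k assume w: "w \<in> space M" and "\<exists>u\<in>C. \<forall>j. g j w u \<le> 0"
    then obtain u where u: "u \<in> C" "\<And>j. g j w u \<le> 0" by blast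
    obtain x where x: "\<And>n. x n \<in> D" "x \<longlonglongrightarrow> u"
      using D(3) u(1) closure_sequential[of u D] by blast
    have "\<forall>j\<in>{..k}. \<forall>\<^sub>F n in sequentially. g j w (x n) < 1 / Suc k"
    proof
      fix j
      have "(\<lambda>n. g j w (x n)) \<longlonglongrightarrow> g j w u"
        by (rule continuous_on_tendsto_compose[OF cont[OF w] x(2) u(1)])
          (use x(1) D(2) in \<open>auto intro!: always_eventually\<close>)
      then show "\<forall>\<^sub>F n in sequentially. g j w (x n) < 1 / Suc k"
        by (rule order_tendstoD) (rule le_less_trans[OF u(2)], simp)
    qed
    then have "\<forall>\<^sub>F n in sequentially. \<forall>j\<in>{..k}. g j w (x n) < 1 / Suc k"
      by (rule eventually_ball_finite[rotated]) simp
    then obtain n where "\<forall>j\<in>{..k}. g j w (x n) < 1 / Suc k"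
      by (auto simp: eventually_sequentially)
    with x(1) show "\<exists>u\<in>D. \<forall>j\<le>k. g j w u < 1 / Suc k" by auto
  next
    fix w assume w: "w \<in> space M" and "\<forall>k. \<exists>u\<in>D. \<forall>j\<le>k. g j w u < 1 / Suc k"
    then obtain x where x: "\<And>k. x k \<in> D" "\<And>k j. j \<le> k \<Longrightarrow> g j w (x k) < 1 / Suc k" by metis
    obtain u r where u: "u \<in> C" and r: "strict_mono (r :: nat \<Rightarrow> nat)" "(x \<circ> r) \<longlonglongrightarrow> u"
      using compact_imp_seq_compact[OF C] x(1) D(2) by (metis seq_compactE subsetD)
    have "g j w u \<le> 0" for j
    proof (rule LIMSEQ_le)
      show "(\<lambda>n. g j w ((x \<circ> r) n)) \<longlonglongrightarrow> g j w u"
        by (rule continuous_on_tendsto_compose[OF cont[OF w] r(2) u])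
          (use x(1) D(2) in \<open>auto intro!: always_eventually\<close>)
      show "(\<lambda>n. 1 / Suc n) \<longlonglongrightarrow> 0" by (rule LIMSEQ_Suc[OF lim_1_over_n])
      have "g j w ((x \<circ> r) n) \<le> 1 / Suc n" if "n \<ge> j" for n
      proof -
        have "n \<le> r n" using r(1) by (rule seq_suble)
        then have "g j w (x (r n)) < 1 / Suc (r n)" using that x(2) by simp
        also have "\<dots> \<le> 1 / Suc n" using \<open>n \<le> r n\<close> by (simp add: frac_le)
        finally show ?thesis by simp
      qed
      then show "\<exists>N. \<forall>n\<ge>N. g j w ((x \<circ> r) n) \<le> 1 / Suc n" by blast
    qed
    with u show "\<exists>u\<in>C. \<forall>j. g j w u \<le> 0" by blast
  qed
  also have "\<dots> \<in> sets M"
    unfolding atMost_iff[symmetric] Ball_def[symmetric]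
  proof (intro sets.sets_Collect_countable_All sets.sets_Collect_countable_Ex'
      sets.sets_Collect_countable_All' D(1) countable_finite[OF finite_atMost])
    fix k u j assume "u \<in> D"
    then have [measurable]: "(\<lambda>w. g j w u) \<in> borel_measurable M" using D(2) meas by blast
    show "{w \<in> space M. g j w u < 1 / Suc k} \<in> sets M" by measurable
  qed
  finally show ?thesis .
qed

section \<open>The weak-star unit ball of the bounded sequences\<close>

lemma topspace_weak_star: "topspace weak_star = UNIV"
proof -
  have "UNIV \<in> {{x :: l_infty. (\<Sum>n. a n * apply_bcontfun x n) \<in> V} | (a :: nat \<Rightarrow> real) V.
      summable (\<lambda>n. \<bar>a n\<bar>) \<and> open V}"
    by (intro CollectI exI[of _ "\<lambda>_. 0"] exI[of _ UNIV]) simp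
  then show ?thesis
    unfolding weak_star_def topology_generated_by_topspace by blast
qed

lemma continuous_map_weak_star_coordinate:
  "continuous_map weak_star euclidean (\<lambda>u. apply_bcontfun u n)"
proof -
  have "openin weak_star {u. apply_bcontfun u n \<in> V}" if V: "open V" for V
  proof -
    \<comment> \<open>Pairing with the \<open>n\<close>-th unit sequence is evaluation at
      \<open>n\<close>.\<close>
    define a where "a k = (if k = n then 1 else 0 :: real)" for k
    have "(\<Sum>k. a k * apply_bcontfun u k) = apply_bcontfun u n" for u :: l_infty
      using suminf_finite[of "{n}" "\<lambda>k. a k * apply_bcontfun u k"] by (simp add: a_def)
    moreover have "summable (\<lambda>k. \<bar>a k\<bar>)"
      by (rule summable_finite[of "{n}"]) (auto simp: a_def)
    ultimately show ?thesis
      unfolding weak_star_def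
      by (intro topology_generated_by_Basis CollectI exI[of _ a] exI[of _ V]) (simp add: V)
  qed
  then show ?thesis by (simp add: continuous_map_def topspace_weak_star)
qed

text \<open>A model of the weak-star ball inside the product of real lines, where compactness is
  Tychonoff's theorem and the topology comes with the type.\<close>

definition unit_cube :: "(nat \<Rightarrow> real) set"
  where "unit_cube = {u. \<forall>n. \<bar>u n\<bar> \<le> 1}"

lemma compact_unit_cube: "compact unit_cube"
proof -
  have "unit_cube = (\<Pi>\<^sub>E n\<in>UNIV. {-1..1})"
    by (auto simp: unit_cube_def PiE_iff abs_le_iff; smt (verit))
  then show ?thesis
    using compactin_PiE[of "\<lambda>_. euclidean :: real topology" "UNIV :: nat set" "\<lambda>_. {-1..1}"]
    by (simp add: euclidean_product_topology)
qed

lemma apply_Bcontfun_nat: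
  assumes "\<And>n. \<bar>u n\<bar> \<le> r"
  shows "apply_bcontfun (Bcontfun u :: l_infty) = u"
  by (rule Bcontfun_inverse, rule bcontfun_normI[of _ r]) (simp_all add: assms)

lemma apply_bcontfun_unit_cube: "apply_bcontfun u \<in> unit_cube \<longleftrightarrow> u \<in> cball (0 :: l_infty) 1"
  unfolding unit_cube_def mem_cball_0 mem_Collect_eq
  using norm_bounded[of u] norm_bound[of u 1] by (auto intro: order_trans)

text \<open>Partial sums depend on finitely many coordinates and converge uniformly on the cube by
  the Weierstrass test with bounds \<open>\<bar>a n\<bar>\<close>.\<close>

lemma continuous_on_weighted_sum:
  assumes a: "summable (\<lambda>n. \<bar>a n\<bar>)"
  shows "continuous_on unit_cube (\<lambda>u. \<Sum>n. a n * u n)"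
proof (rule uniform_limit_theorem)
  show "uniform_limit unit_cube (\<lambda>n u. \<Sum>k<n. a k * u k) (\<lambda>u. \<Sum>n. a n * u n) sequentially"
    by (rule Weierstrass_m_test[OF _ a])
      (auto simp: abs_mult unit_cube_def intro: mult_left_le)
  show "\<forall>\<^sub>F n in sequentially. continuous_on unit_cube (\<lambda>u. \<Sum>k<n. a k * u k)"
    by (intro always_eventually allI continuous_intros
        continuous_on_subset[OF continuous_on_product_coordinates]) auto
qed simp

text \<open>On the unit ball the weak-star topology is that of coordinatewise convergence:
  coordinates are weak-star continuous, and conversely every summable pairing is continuous on the
  cube.\<close>

lemma homeomorphic_maps_ball_l_infty:
  "homeomorphic_maps ball_l_infty (top_of_set unit_cube) apply_bcontfun Bcontfun"
  unfolding homeomorphic_maps_def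
proof (intro conjI)
  have top: "topspace ball_l_infty = cball 0 1"
    by (simp add: ball_l_infty_def topspace_weak_star)
  have "continuous_map weak_star euclidean (apply_bcontfun :: l_infty \<Rightarrow> nat \<Rightarrow> real)"
    using continuous_map_weak_star_coordinate
    by (simp flip: euclidean_product_topology add: continuous_map_componentwise_UNIV)
  then show "continuous_map ball_l_infty (top_of_set unit_cube) apply_bcontfun"
    unfolding continuous_map_in_subtopology top
    by (auto simp: ball_l_infty_def continuous_map_from_subtopology apply_bcontfun_unit_cube
        simp del: mem_cball mem_cball_0)
  have app: "apply_bcontfun (Bcontfun u :: l_infty) = u" if "u \<in> unit_cube" for u
    using that by (intro apply_Bcontfun_nat[of u 1]) (simp add: unit_cube_def)
  have "continuous_map (top_of_set unit_cube) weak_star Bcontfun"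
    unfolding weak_star_def
  proof (rule continuous_on_generated_topo)
    fix U assume "U \<in> {{x :: l_infty. (\<Sum>n. a n * apply_bcontfun x n) \<in> V} | (a :: nat \<Rightarrow> real) V.
      summable (\<lambda>n. \<bar>a n\<bar>) \<and> open V}"
    then obtain a V where U: "U = {x :: l_infty. (\<Sum>n. a n * apply_bcontfun x n) \<in> V}"
      and a: "summable (\<lambda>n. \<bar>a n\<bar>)" and V: "open (V :: real set)" by blast
    have "Bcontfun -` U \<inter> topspace (top_of_set unit_cube) = unit_cube \<inter> (\<lambda>u. \<Sum>n. a n * u n) -` V"
      by (auto simp: U app)
    then show "openin (top_of_set unit_cube) (Bcontfun -` U \<inter> topspace (top_of_set unit_cube))"
      using continuous_openin_preimage_gen[OF continuous_on_weighted_sum[OF a] V] by simp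
  next
    show "Bcontfun ` topspace (top_of_set unit_cube) \<subseteq>
      \<Union>{{x :: l_infty. (\<Sum>n. a n * apply_bcontfun x n) \<in> V} | (a :: nat \<Rightarrow> real) V.
      summable (\<lambda>n. \<bar>a n\<bar>) \<and> open V}"
      using topspace_weak_star unfolding weak_star_def topology_generated_by_topspace by simp
  qed
  moreover have "Bcontfun u \<in> cball (0 :: l_infty) 1" if "u \<in> unit_cube" for u
    using that app[OF that] apply_bcontfun_unit_cube[of "Bcontfun u"] by simp
  ultimately show "continuous_map (top_of_set unit_cube) ball_l_infty Bcontfun"
    unfolding ball_l_infty_def continuous_map_in_subtopology by simp
  show "\<forall>u\<in>topspace ball_l_infty. Bcontfun (apply_bcontfun u) = u"
    by (simp add: apply_bcontfun_inverse)
  show "\<forall>u\<in>topspace (top_of_set unit_cube). apply_bcontfun (Bcontfun u :: l_infty) = u"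
    by (simp add: app)
qed

lemma ball_l_infty_homeomorphic: "ball_l_infty homeomorphic_space top_of_set unit_cube"
  using homeomorphic_maps_ball_l_infty unfolding homeomorphic_space_def by blast

lemma second_countable_euclidean: "second_countable (euclidean :: 'a::second_countable_topology topology)"
proof -
  obtain B :: "'a set set" where "countable B" "topological_basis B"
    using ex_countable_basis by blast
  then show ?thesis
    unfolding second_countable_def by (intro exI[of _ B]) (auto simp: topological_basis_open elim!: topological_basisE)
qed

lemma second_countable_ball_l_infty: "second_countable ball_l_infty"
  using homeomorphic_space_second_countability[OF ball_l_infty_homeomorphic]
    second_countable_subtopology[OF second_countable_euclidean] by blast

lemma metrizable_space_ball_l_infty: "metrizable_space ball_l_infty"
  using homeomorphic_metrizable_space[OF ball_l_infty_homeomorphic]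
  by (simp add: metrizable_space_euclidean metrizable_space_subtopology)

section \<open>Coordinates of functionals along a dense sequence\<close>

lemma dual_zero: "subspace X \<Longrightarrow> f \<in> dual X \<Longrightarrow> f 0 = 0"
  using subspace_0[of X] by (force simp: dual_def dest: spec[of _ 0])

lemma dual_diff:
  assumes "subspace X" "f \<in> dual X" "x \<in> X" "y \<in> X"
  shows "f (x - y) = f x - f y"
proof -
  have "f (x + (-1) *\<^sub>R y) = f x + f ((-1) *\<^sub>R y)"
    using assms subspace_scale[of X y "-1"] by (auto simp: dual_def)
  also have "f ((-1) *\<^sub>R y) = -1 * f y"
    using assms by (simp only: dual_def mem_Collect_eq)
  finally show ?thesis by simp
qed

text \<open>The supremum in \<open>dual_norm\<close> is taken in the reals, so it bounds its family
  only once that family is known to be bounded.\<close>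

lemma bdd_above_dual:
  assumes "f \<in> dual X"
  shows "bdd_above ((\<lambda>x. \<bar>f x\<bar>) ` {x \<in> X. norm x \<le> 1})"
proof -
  obtain C where C: "\<And>x. x \<in> X \<Longrightarrow> \<bar>f x\<bar> \<le> C * norm x" using assms unfolding dual_def by blast
  show ?thesis
  proof (rule bdd_aboveI2)
    fix x assume x: "x \<in> {x \<in> X. norm x \<le> 1}"
    then have "\<bar>f x\<bar> \<le> C * norm x" by (simp add: C)
    \<comment> \<open>The constant in \<open>dual\<close> may be negative when \<open>X\<close> is
      trivial, hence the absolute value.\<close>
    also have "\<dots> \<le> \<bar>C\<bar> * 1" using x by (intro mult_mono) auto
    finally show "\<bar>f x\<bar> \<le> \<bar>C\<bar>" by simp
  qed
qed

lemma abs_le_dual_norm: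
  assumes X: "subspace X" and f: "f \<in> dual X" and x: "x \<in> X"
  shows "\<bar>f x\<bar> \<le> dual_norm X f * norm x"
proof (cases "x = 0")
  case True
  then show ?thesis using dual_zero[OF X f] by simp
next
  case False
  note bdd_above_dual[OF f]
  moreover have "(1 / norm x) *\<^sub>R x \<in> {x \<in> X. norm x \<le> 1}"
    using False x X by (simp add: subspace_scale)
  ultimately have "\<bar>f ((1 / norm x) *\<^sub>R x)\<bar> \<le> dual_norm X f"
    unfolding dual_norm_def by (intro cSUP_upper)
  moreover have "f ((1 / norm x) *\<^sub>R x) = (1 / norm x) * f x"
    using f x by (simp only: dual_def mem_Collect_eq)
  ultimately show ?thesis using False by (simp add: abs_mult field_simps)
qed

lemma dual_norm_le:
  assumes "subspace X" "\<And>x. x \<in> X \<Longrightarrow> norm x \<le> 1 \<Longrightarrow> \<bar>f x\<bar> \<le> C"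
  shows "dual_norm X f \<le> C"
  unfolding dual_norm_def
proof (rule cSUP_least)
  have "0 \<in> {x \<in> X. norm x \<le> 1}" using assms(1) by (simp add: subspace_0)
  then show "{x \<in> X. norm x \<le> 1} \<noteq> {}" by blast
qed (use assms(2) in auto)

lemma dual_norm_nonneg:
  assumes "subspace X" "f \<in> dual X"
  shows "0 \<le> dual_norm X f"
proof -
  note bdd_above_dual[OF assms(2)]
  moreover have "0 \<in> {x \<in> X. norm x \<le> 1}" using assms(1) by (simp add: subspace_0)
  ultimately have "\<bar>f 0\<bar> \<le> dual_norm X f" unfolding dual_norm_def by (intro cSUP_upper)
  then show ?thesis by simp
qed

lemma dual_ball_iff:
  assumes X: "subspace X"
  shows "f \<in> dual_ball X \<longleftrightarrow> f \<in> dual X \<and> (\<forall>x\<in>X. \<bar>f x\<bar> \<le> norm x)"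
proof (intro iffI conjI ballI)
  assume f: "f \<in> dual_ball X"
  then show "f \<in> dual X" by (simp add: dual_ball_def)
  fix x assume "x \<in> X"
  with f show "\<bar>f x\<bar> \<le> norm x"
    using abs_le_dual_norm[OF X, of f x] mult_right_mono[of "dual_norm X f" 1 "norm x"]
    by (simp add: dual_ball_def)
next
  assume "f \<in> dual X \<and> (\<forall>x\<in>X. \<bar>f x\<bar> \<le> norm x)"
  then show "f \<in> dual_ball X"
    unfolding dual_ball_def using dual_norm_le[OF X, of f 1] by fastforce
qed

lemma dual_add: "subspace X \<Longrightarrow> f \<in> dual X \<Longrightarrow> g \<in> dual X \<Longrightarrow> (\<lambda>x. f x + g x) \<in> dual X"
proof -
  assume X: "subspace X" and f: "f \<in> dual X" and g: "g \<in> dual X"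
  have "\<bar>f x + g x\<bar> \<le> (dual_norm X f + dual_norm X g) * norm x" if "x \<in> X" for x
    using abs_le_dual_norm[OF X f that] abs_le_dual_norm[OF X g that] by (simp add: distrib_right)
  then have "\<exists>C. \<forall>x\<in>X. \<bar>f x + g x\<bar> \<le> C * norm x" by blast
  with f g show ?thesis
    unfolding dual_def mem_Collect_eq by (intro conjI) (simp_all add: distrib_left)
qed

lemma dual_cmult: "subspace X \<Longrightarrow> f \<in> dual X \<Longrightarrow> (\<lambda>x. c * f x) \<in> dual X"
proof -
  assume X: "subspace X" and f: "f \<in> dual X"
  have "\<bar>c * f x\<bar> \<le> (\<bar>c\<bar> * dual_norm X f) * norm x" if "x \<in> X" for x
    using mult_left_mono[OF abs_le_dual_norm[OF X f that], of "\<bar>c\<bar>"] by (simp add: abs_mult mult.assoc)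
  then have "\<exists>C. \<forall>x\<in>X. \<bar>c * f x\<bar> \<le> C * norm x" by blast
  with f show ?thesis
    unfolding dual_def mem_Collect_eq by (intro conjI) (simp_all add: distrib_left)
qed

lemma dual_tendsto:
  assumes X: "subspace X" and f: "f \<in> dual X" and "\<And>k. s k \<in> X" "x \<in> X" "s \<longlonglongrightarrow> x"
  shows "(\<lambda>k. f (s k)) \<longlonglongrightarrow> f x"
proof (rule LIM_zero_cancel, rule Lim_null_comparison)
  show "\<forall>\<^sub>F k in sequentially. norm (f (s k) - f x) \<le> dual_norm X f * norm (s k - x)"
  proof (intro always_eventually allI)
    fix k
    show "norm (f (s k) - f x) \<le> dual_norm X f * norm (s k - x)"
      using abs_le_dual_norm[OF X f, of "s k - x"] assms
      by (simp add: dual_diff subspace_diff)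
  qed
  show "(\<lambda>k. dual_norm X f * norm (s k - x)) \<longlonglongrightarrow> 0"
    using tendsto_mult_right_zero[OF tendsto_norm_zero[OF LIM_zero[OF \<open>s \<longlonglongrightarrow> x\<close>]]] by simp
qed

text \<open>The vectors \<open>d n /\<^sub>R weight d n\<close> are dense in the unit ball of the closure of \<open>range d\<close>, and the
  weight never vanishes, unlike \<open>norm (d n)\<close>.\<close>

definition weight :: "(nat \<Rightarrow> 'a::real_normed_vector) \<Rightarrow> nat \<Rightarrow> real"
  where "weight d n = max 1 (norm (d n))"

definition coords :: "(nat \<Rightarrow> 'a::real_normed_vector) \<Rightarrow> ('a \<Rightarrow> real) \<Rightarrow> l_infty"
  where "coords d f = Bcontfun (\<lambda>n. f (d n) / weight d n)"

text \<open>A least index makes the approximation of \<open>x\<close> a measurable choice. The bound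
  uses \<open>Suc k\<close> because \<open>1 / 0\<close> is 0 and no index would qualify.\<close>

definition approx_index :: "(nat \<Rightarrow> 'a::metric_space) \<Rightarrow> 'a \<Rightarrow> nat \<Rightarrow> nat"
  where "approx_index d x k = (LEAST n. dist x (d n) < 1 / Suc k)"

text \<open>Multiplying by the weight undoes the division in \<open>coords\<close> and gives the
  functional at vectors of the sequence; the limit recovers its value at \<open>x\<close>.\<close>

definition eval_coords :: "(nat \<Rightarrow> 'a::real_normed_vector) \<Rightarrow> l_infty \<Rightarrow> 'a \<Rightarrow> real"
  where "eval_coords d u x =
    lim (\<lambda>k. weight d (approx_index d x k) * u (approx_index d x k))"

text \<open>Nonpositivity of all defects says that \<open>d n \<mapsto> weight d n * u n\<close> extends to a contractive
  linear functional. The scalar is rational only to keep the family of constraints countable.\<close>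

definition defect :: "(nat \<Rightarrow> 'a::real_normed_vector) \<Rightarrow> rat \<times> nat \<times> nat \<times> nat \<Rightarrow> (nat \<Rightarrow> real) \<Rightarrow> real"
  where "defect d = (\<lambda>(p, n, m, l) u.
    \<bar>of_rat p * (weight d n * u n) + weight d m * u m - weight d l * u l\<bar>
    - norm (of_rat p *\<^sub>R d n + d m - d l))"

lemma weight_pos: "0 < weight d n" "1 \<le> weight d n" "norm (d n) \<le> weight d n"
  by (auto simp: weight_def)

lemma continuous_on_defect: "continuous_on UNIV (defect d j)"
  unfolding defect_def
  by (cases j) (auto intro!: continuous_intros continuous_on_product_coordinates)

section \<open>One subspace with a fixed dense sequence\<close>

locale dense_sequence =
  fixes X :: "'a::real_normed_vector set" and d :: "nat \<Rightarrow> 'a"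
  assumes X: "subspace X" and dense: "closure (range d) = X"
begin

lemma d_in: "d n \<in> X"
  using dense closure_subset[of "range d"] by blast

lemma approx_index_tendsto:
  assumes "x \<in> X"
  shows "(\<lambda>k. d (approx_index d x k)) \<longlonglongrightarrow> x"
proof -
  have "dist x (d (approx_index d x k)) < 1 / Suc k" for k
  proof -
    have "x \<in> closure (range d)" using dense assms by simp
    then have "\<exists>y\<in>range d. dist y x < 1 / Suc k" unfolding closure_approachable by simp
    then have "\<exists>n. dist x (d n) < 1 / Suc k" by (auto simp: dist_commute)
    then show ?thesis unfolding approx_index_def by (rule LeastI_ex)
  qed
  then have "(\<lambda>k. dist (d (approx_index d x k)) x) \<longlonglongrightarrow> 0"
    by (intro real_tendsto_sandwich[OF _ _ tendsto_const LIMSEQ_Suc[OF lim_1_over_n]])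
      (auto simp: dist_commute intro!: always_eventually less_imp_le)
  then show ?thesis by (rule tendsto_dist_iff[THEN iffD2])
qed

text \<open>\<open>Bcontfun\<close> can be undone only on bounded sequences; here the quotients are
  bounded by the dual norm, because \<open>norm (d n) \<le> weight d n\<close>.\<close>

lemma apply_coords:
  assumes f: "f \<in> dual X"
  shows "apply_bcontfun (coords d f) n = f (d n) / weight d n"
proof -
  have "\<bar>f (d n) / weight d n\<bar> \<le> dual_norm X f" for n
  proof -
    have "\<bar>f (d n)\<bar> \<le> dual_norm X f * weight d n"
      using abs_le_dual_norm[OF X f d_in] mult_left_mono[OF weight_pos(3) dual_norm_nonneg[OF X f]]
      by (rule order_trans)
    then show ?thesis using weight_pos(1)[of d n] by (simp add: field_simps)
  qed
  from apply_Bcontfun_nat[of "\<lambda>n. f (d n) / weight d n", OF this]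
  show ?thesis unfolding coords_def by simp
qed

text \<open>The bound is immediate at the vectors \<open>d n\<close> and passes to limits. On the
  unit ball of \<open>X\<close> the factor is 1, which is why dividing by the weight yields an
  isometry.\<close>

lemma abs_le_coords:
  assumes f: "f \<in> dual X" and x: "x \<in> X"
  shows "\<bar>f x\<bar> \<le> max 1 (norm x) * norm (coords d f)"
proof (rule LIMSEQ_le)
  let ?s = "\<lambda>k. d (approx_index d x k)"
  show "(\<lambda>k. \<bar>f (?s k)\<bar>) \<longlonglongrightarrow> \<bar>f x\<bar>"
    by (intro tendsto_intros dual_tendsto[OF X f d_in x approx_index_tendsto[OF x]])
  show "(\<lambda>k. max 1 (norm (?s k)) * norm (coords d f)) \<longlonglongrightarrow> max 1 (norm x) * norm (coords d f)"
    by (intro tendsto_intros approx_index_tendsto[OF x])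
  have "\<bar>f (d n)\<bar> \<le> max 1 (norm (d n)) * norm (coords d f)" for n
    using norm_bounded[of "coords d f" n] weight_pos(1)[of d n]
    by (simp add: apply_coords[OF f] weight_def field_simps)
  then show "\<exists>N. \<forall>k\<ge>N. \<bar>f (?s k)\<bar> \<le> max 1 (norm (?s k)) * norm (coords d f)" by blast
qed

lemma norm_coords:
  assumes f: "f \<in> dual X"
  shows "norm (coords d f) = dual_norm X f"
proof (rule antisym)
  show "norm (coords d f) \<le> dual_norm X f"
  proof (rule norm_bound)
    fix n
    have "\<bar>f (d n)\<bar> \<le> dual_norm X f * weight d n"
      using abs_le_dual_norm[OF X f d_in] mult_left_mono[OF weight_pos(3) dual_norm_nonneg[OF X f]]
      by (rule order_trans)
    then show "norm (coords d f n) \<le> dual_norm X f"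
      using weight_pos(1)[of d n] by (simp add: apply_coords[OF f] field_simps)
  qed
  show "dual_norm X f \<le> norm (coords d f)"
  proof (rule dual_norm_le[OF X])
    fix x assume "x \<in> X" "norm x \<le> 1"
    then show "\<bar>f x\<bar> \<le> norm (coords d f)"
      using abs_le_coords[OF f, of x] by (simp add: max_absorb1)
  qed
qed

lemma coords_add: "f \<in> dual X \<Longrightarrow> g \<in> dual X \<Longrightarrow> coords d (\<lambda>x. f x + g x) = coords d f + coords d g"
  by (rule bcontfun_eqI) (simp add: apply_coords dual_add X plus_bcontfun.rep_eq add_divide_distrib)

lemma coords_cmult: "f \<in> dual X \<Longrightarrow> coords d (\<lambda>x. c * f x) = c *\<^sub>R coords d f"
  by (rule bcontfun_eqI) (simp add: apply_coords dual_cmult X scaleR_bcontfun.rep_eq)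

lemma coords_diff: "f \<in> dual X \<Longrightarrow> g \<in> dual X \<Longrightarrow> coords d (\<lambda>x. f x - g x) = coords d f - coords d g"
  using coords_add[of f "\<lambda>x. (-1) * g x"] coords_cmult[of g "-1"] dual_cmult[OF X, of g "-1"] by simp

lemma dual_minus: "f \<in> dual X \<Longrightarrow> g \<in> dual X \<Longrightarrow> (\<lambda>x. f x - g x) \<in> dual X"
  using dual_add[OF X, of f "\<lambda>x. (-1) * g x"] dual_cmult[OF X, of g "-1"] by simp

text \<open>The second claim asserts genuine convergence, through which the pairing becomes a
  pointwise limit of measurable functions.\<close>

lemma eval_coords_coords:
  assumes f: "f \<in> dual X" and x: "x \<in> X"
  shows "eval_coords d (coords d f) x = f x"
    and "(\<lambda>k. weight d (approx_index d x k) * coords d f (approx_index d x k)) \<longlonglongrightarrow> f x"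
proof -
  have "weight d n * coords d f n = f (d n)" for n
    using weight_pos(1)[of d n] by (simp add: apply_coords[OF f])
  then show "(\<lambda>k. weight d (approx_index d x k) * coords d f (approx_index d x k)) \<longlonglongrightarrow> f x"
    using dual_tendsto[OF X f d_in x approx_index_tendsto[OF x]] by simp
  then show "eval_coords d (coords d f) x = f x"
    unfolding eval_coords_def by (rule limI)
qed

text \<open>Scalar 0 shows that \<open>w\<close> is 1-Lipschitz along \<open>d\<close>, so it
  extends to \<open>X\<close> by limits. The inequality passes to all vectors of \<open>X\<close>
  and, by closedness, to real scalars. Vectors that make the right-hand side vanish then give
  homogeneity and additivity, and two zero vectors give the norm bound.\<close>

lemma extend_to_dual_ball:
  assumes w: "\<And>p n m l. \<bar>of_rat p * w n + w m - w l\<bar> \<le> norm (of_rat p *\<^sub>R d n + d m - d l)"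
  obtains f where "f \<in> dual_ball X" "\<And>n. f (d n) = w n"
proof -
  define a where "a = approx_index d"
  have a: "(\<lambda>k. d (a x k)) \<longlonglongrightarrow> x" if "x \<in> X" for x
    using approx_index_tendsto[OF that] by (simp add: a_def)
  have lip: "\<bar>w m - w l\<bar> \<le> dist (d m) (d l)" for m l
    using w[of 0 0 m l] by (simp add: dist_norm)
  define f where "f x = (if x \<in> X then lim (\<lambda>k. w (a x k)) else 0)" for x
  have f: "(\<lambda>k. w (a x k)) \<longlonglongrightarrow> f x" if x: "x \<in> X" for x
  proof -
    have "Cauchy (\<lambda>k. d (a x k))" using a[OF x] by (rule LIMSEQ_imp_Cauchy)
    then have "Cauchy (\<lambda>k. w (a x k))"
      unfolding Cauchy_def dist_real_def using lip by (meson order_le_less_trans)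
    then show ?thesis
      using x by (simp add: f_def real_Cauchy_convergent convergent_LIMSEQ_iff[symmetric])
  qed
  have rat: "\<bar>of_rat p * f x + f y - f z\<bar> \<le> norm (of_rat p *\<^sub>R x + y - z)"
    if "x \<in> X" "y \<in> X" "z \<in> X" for p x y z
  proof (rule LIMSEQ_le)
    show "(\<lambda>k. \<bar>of_rat p * w (a x k) + w (a y k) - w (a z k)\<bar>) \<longlonglongrightarrow> \<bar>of_rat p * f x + f y - f z\<bar>"
      by (intro tendsto_intros f that)
    show "(\<lambda>k. norm (of_rat p *\<^sub>R d (a x k) + d (a y k) - d (a z k)))
        \<longlonglongrightarrow> norm (of_rat p *\<^sub>R x + y - z)"
      by (intro tendsto_intros a that)
  qed (use w in blast)
  have real: "\<bar>c * f x + f y - f z\<bar> \<le> norm (c *\<^sub>R x + y - z)"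
    if "x \<in> X" "y \<in> X" "z \<in> X" for c x y z
  proof -
    let ?S = "{c. \<bar>c * f x + f y - f z\<bar> \<le> norm (c *\<^sub>R x + y - z)}"
    have "closed ?S" by (intro closed_Collect_le continuous_intros)
    moreover have "\<rat> \<subseteq> ?S" using rat[OF that] by (auto elim: Rats_cases)
    ultimately have "closure \<rat> \<subseteq> ?S" by (rule closure_minimal[rotated])
    then show ?thesis by (auto simp: Rats_closure_real)
  qed
  have f0: "f 0 = 0" using real[of 0 0 0 1] subspace_0[OF X] by simp
  have scale: "f (c *\<^sub>R x) = c * f x" if "x \<in> X" for c x
    using real[of x 0 "c *\<^sub>R x" c] that X by (simp add: subspace_0 subspace_scale f0)
  have add: "f (x + y) = f x + f y" if "x \<in> X" "y \<in> X" for x y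
    using real[of x y "x + y" 1] that X by (simp add: subspace_add)
  have bound: "\<bar>f x\<bar> \<le> norm x" if "x \<in> X" for x
    using real[of x 0 0 1] that X by (simp add: subspace_0 f0)
  show thesis
  proof (rule that[of f])
    have "f \<in> dual X"
      unfolding dual_def using add scale bound by (auto simp: f_def intro!: exI[of _ 1])
    with bound show "f \<in> dual_ball X" by (simp add: dual_ball_iff[OF X])
    fix n
    \<comment> \<open>The indices approximating \<open>d n\<close> need not be \<open>n\<close>
      itself; the Lipschitz bound still forces their values to converge to
      \<open>w n\<close>.\<close>
    have "(\<lambda>k. w (a (d n) k) - w n) \<longlonglongrightarrow> 0"
    proof (rule Lim_null_comparison)
      show "\<forall>\<^sub>F k in sequentially. norm (w (a (d n) k) - w n) \<le> dist (d (a (d n) k)) (d n)"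
        using lip by simp
      show "(\<lambda>k. dist (d (a (d n) k)) (d n)) \<longlonglongrightarrow> 0"
        using a[OF d_in] by (simp add: tendsto_dist_iff[symmetric])
    qed
    from LIM_zero_cancel[OF this] f[OF d_in] show "f (d n) = w n"
      by (metis LIMSEQ_unique)
  qed
qed

text \<open>Describes the image by countably many inequalities that are continuous in the
  coordinates of \<open>u\<close>. Norm closedness, weak-star compactness and measurability in the
  subspace all rest on this form.\<close>

lemma coords_dual_ball:
  "coords d ` dual_ball X = {u \<in> cball 0 1. \<forall>j. defect d j (apply_bcontfun u) \<le> 0}"
proof (intro equalityI subsetI)
  fix u assume "u \<in> coords d ` dual_ball X"
  then obtain f where u: "u = coords d f" and fb: "f \<in> dual_ball X" by blast
  then have f: "f \<in> dual X" and le: "\<And>x. x \<in> X \<Longrightarrow> \<bar>f x\<bar> \<le> norm x"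
    by (auto simp: dual_ball_iff[OF X])
  have "norm u \<le> 1" using fb by (simp add: u norm_coords[OF f] dual_ball_def)
  moreover have "defect d j (apply_bcontfun u) \<le> 0" for j
  proof -
    obtain p n m l where j: "j = (p, n, m, l)" by (cases j)
    have wt: "weight d n * u n = f (d n)" for n
      using weight_pos(1)[of d n] by (simp add: u apply_coords[OF f])
    have "of_rat p *\<^sub>R d n \<in> X" "of_rat p *\<^sub>R d n + d m \<in> X" "of_rat p *\<^sub>R d n + d m - d l \<in> X"
      using X d_in by (auto intro: subspace_add subspace_diff subspace_scale)
    moreover from this have "f (of_rat p *\<^sub>R d n + d m - d l) = of_rat p * f (d n) + f (d m) - f (d l)"
      using f d_in by (simp add: dual_diff[OF X f]) (simp add: dual_def)
    ultimately show ?thesis using le by (fastforce simp: j defect_def wt)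
  qed
  ultimately show "u \<in> {u \<in> cball 0 1. \<forall>j. defect d j (apply_bcontfun u) \<le> 0}" by simp
next
  fix u :: l_infty assume u: "u \<in> {u \<in> cball 0 1. \<forall>j. defect d j (apply_bcontfun u) \<le> 0}"
  have w: "\<bar>of_rat p * (weight d n * u n) + weight d m * u m - weight d l * u l\<bar>
    \<le> norm (of_rat p *\<^sub>R d n + d m - d l)" for p n m l
    using u by (force simp: defect_def dest: spec[of _ "(p, n, m, l)"])
  obtain f where f: "f \<in> dual_ball X" "\<And>n. f (d n) = weight d n * u n"
    using extend_to_dual_ball[of "\<lambda>n. weight d n * u n", OF w] by blast
  have "f \<in> dual X" using f(1) by (simp add: dual_ball_def)
  then have "coords d f = u"
    using weight_pos(1)[of d] by (intro bcontfun_eqI) (simp add: apply_coords f(2) less_imp_neq[symmetric])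
  with f(1) show "u \<in> coords d ` dual_ball X" by blast
qed

lemma closed_coords_dual_ball: "closed (coords d ` dual_ball X)"
proof -
  have "continuous_on UNIV (apply_bcontfun :: l_infty \<Rightarrow> nat \<Rightarrow> real)"
    by (intro continuous_on_coordinatewise_then_product)
      (use dist_fun_lt_imp_dist_val_lt in \<open>unfold continuous_on_iff, blast\<close>)
  then have "continuous_on UNIV (\<lambda>u :: l_infty. defect d j (apply_bcontfun u))" for j
    by (rule continuous_on_compose2[OF continuous_on_defect]) simp
  then have "closed {u :: l_infty. \<forall>j. defect d j (apply_bcontfun u) \<le> 0}"
    by (intro closed_Collect_all closed_Collect_le continuous_on_const)
  from closed_Int[OF closed_cball this] show ?thesis
    unfolding coords_dual_ball Collect_conj_eq Collect_mem_eq .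
qed

text \<open>Defects are continuous for the product topology, so the image corresponds to a closed
  subset of the compact cube.\<close>

lemma compactin_coords_dual_ball: "compactin ball_l_infty (coords d ` dual_ball X)"
proof -
  define K where "K = unit_cube \<inter> {u. \<forall>j. defect d j u \<le> 0}"
  have "closed {u. \<forall>j. defect d j u \<le> 0}"
    by (intro closed_Collect_all closed_Collect_le continuous_on_const continuous_on_defect)
  then have "compactin (top_of_set unit_cube) K"
    unfolding K_def by (simp add: compactin_subtopology compact_Int_closed compact_unit_cube)
  moreover have "continuous_map (top_of_set unit_cube) ball_l_infty Bcontfun"
    using homeomorphic_maps_ball_l_infty by (simp add: homeomorphic_maps_def)
  moreover have "coords d ` dual_ball X = Bcontfun ` K"
  proof (intro equalityI subsetI)
    fix u assume "u \<in> coords d ` dual_ball X"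
    then have "apply_bcontfun u \<in> K"
      unfolding coords_dual_ball K_def using apply_bcontfun_unit_cube[of u] by simp
    then show "u \<in> Bcontfun ` K" by (rule rev_image_eqI) (simp add: apply_bcontfun_inverse)
  next
    fix u assume "u \<in> Bcontfun ` K"
    then obtain v where v: "v \<in> K" and u: "u = Bcontfun v" by blast
    have "apply_bcontfun (Bcontfun v :: l_infty) = v"
      using v by (intro apply_Bcontfun_nat[of v 1]) (simp add: K_def unit_cube_def)
    with v show "u \<in> coords d ` dual_ball X"
      unfolding coords_dual_ball u using apply_bcontfun_unit_cube[of "Bcontfun v"] by (simp add: K_def)
  qed
  ultimately show ?thesis by (simp add: image_compactin)
qed

lemma dual_eq_scaled_dual_ball:
  assumes f: "f \<in> dual X" and r: "dual_norm X f \<le> r" "0 < r"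
  shows "(\<lambda>x. (1 / r) * f x) \<in> dual_ball X"
proof -
  have "\<bar>(1 / r) * f x\<bar> \<le> norm x" if "x \<in> X" for x
  proof -
    have "\<bar>f x\<bar> \<le> r * norm x"
      using abs_le_dual_norm[OF X f that] mult_right_mono[OF r(1), of "norm x"] by simp
    then show ?thesis using r(2) by (simp add: abs_mult field_simps)
  qed
  then show ?thesis by (simp only: dual_ball_iff[OF X] dual_cmult[OF X f]) simp
qed

text \<open>Every functional is a multiple of one in the dual ball, so its coordinates lie in the
  span. That the range is closed follows from the closedness of the image of the ball: a convergent
  sequence is eventually bounded and can be scaled into that image.\<close>

lemma coords_dual: "coords d ` dual X = closure (span (coords d ` dual_ball X))"
proof
  have mem: "coords d f \<in> span (coords d ` dual_ball X)" if f: "f \<in> dual X" for f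
  proof -
    \<comment> \<open>Adding 1 keeps the divisor positive for the zero functional too.\<close>
    let ?r = "dual_norm X f + 1"
    have r: "0 < ?r" using dual_norm_nonneg[OF X f] by simp
    then have "(\<lambda>x. (1 / ?r) * f x) \<in> dual_ball X" by (intro dual_eq_scaled_dual_ball[OF f]) auto
    then have "?r *\<^sub>R coords d (\<lambda>x. (1 / ?r) * f x) \<in> span (coords d ` dual_ball X)"
      by (intro span_scale span_base imageI)
    then show ?thesis using r coords_cmult[OF f, of "1 / ?r"] by simp
  qed
  then show "coords d ` dual X \<subseteq> closure (span (coords d ` dual_ball X))"
    using closure_subset by blast
  have "subspace (coords d ` dual X)"
  proof (rule subspaceI)
    have "(\<lambda>_. 0) \<in> dual X" by (auto simp: dual_def intro!: exI[of _ 0])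
    then show "0 \<in> coords d ` dual X"
      using coords_cmult[of "\<lambda>_. 0" 0] by (force intro: image_eqI)
  next
    fix u v assume "u \<in> coords d ` dual X" "v \<in> coords d ` dual X"
    then show "u + v \<in> coords d ` dual X"
      using coords_add[symmetric] dual_add[OF X] by blast
  next
    fix c u assume "u \<in> coords d ` dual X"
    then show "c *\<^sub>R u \<in> coords d ` dual X"
      using coords_cmult[symmetric] dual_cmult[OF X] by blast
  qed
  moreover have "coords d ` dual_ball X \<subseteq> coords d ` dual X" by (auto simp: dual_ball_def)
  ultimately have span: "span (coords d ` dual_ball X) \<subseteq> coords d ` dual X"
    by (rule span_minimal[rotated])
  show "closure (span (coords d ` dual_ball X)) \<subseteq> coords d ` dual X"
  proof
    fix v assume "v \<in> closure (span (coords d ` dual_ball X))"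
    then have "v \<in> closure (coords d ` dual X)" using closure_mono[OF span] by blast
    then obtain s where s: "\<And>k. s k \<in> coords d ` dual X" "s \<longlonglongrightarrow> v"
      by (auto simp: closure_sequential)
    \<comment> \<open>Strictly above \<open>norm v\<close>, so the norms of \<open>s k\<close>
      eventually fall below it.\<close>
    let ?r = "norm v + 1"
    have r: "0 < ?r" by (simp add: add_nonneg_pos)
    have "\<forall>\<^sub>F k in sequentially. norm (s k) < ?r"
      by (rule order_tendstoD(2)[OF tendsto_norm[OF s(2)]]) simp
    then have "\<forall>\<^sub>F k in sequentially. (1 / ?r) *\<^sub>R s k \<in> coords d ` dual_ball X"
    proof eventually_elim
      case (elim k)
      obtain f where f: "f \<in> dual X" "s k = coords d f" using s(1)[of k] by blast
      with elim have "(\<lambda>x. (1 / ?r) * f x) \<in> dual_ball X"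
        by (intro dual_eq_scaled_dual_ball r) (auto simp: norm_coords)
      with coords_cmult[OF f(1), of "1 / ?r"] f(2) show ?case by (metis image_eqI)
    qed
    then have "(1 / ?r) *\<^sub>R v \<in> coords d ` dual_ball X"
      by (rule Lim_in_closed_set[OF closed_coords_dual_ball _ _ tendsto_scaleR[OF tendsto_const s(2)]]) simp
    then have "?r *\<^sub>R ((1 / ?r) *\<^sub>R v) \<in> coords d ` dual X"
      using \<open>subspace (coords d ` dual X)\<close> \<open>coords d ` dual_ball X \<subseteq> coords d ` dual X\<close>
      by (blast intro: subspace_scale)
    then show "v \<in> coords d ` dual X" using r by simp
  qed
qed

lemma dual_linear_isometry_coords:
  "dual_linear_isometry (coords d) X (closure (span (coords d ` dual_ball X)))"
  unfolding dual_linear_isometry_def coords_dual[symmetric]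
  using coords_add coords_cmult norm_coords by blast

text \<open>With \<open>u\<close> and \<open>u0\<close> the coordinates of \<open>f\<close> and
  \<open>g\<close>, the difference \<open>f x - g x0\<close> splits into \<open>f (x - x0)\<close>,
  controlled because \<open>f\<close> is contractive, and \<open>(f - g) x0\<close>, controlled by
  the distance of \<open>u\<close> and \<open>u0\<close>.\<close>

lemma continuous_on_eval_coords:
  "continuous_on (X \<times> coords d ` dual_ball X) (\<lambda>(x, u). eval_coords d u x)"
  unfolding continuous_on_def
proof
  fix z0 assume "z0 \<in> X \<times> coords d ` dual_ball X"
  then obtain x0 g where z0: "z0 = (x0, coords d g)" and x0: "x0 \<in> X" and gb: "g \<in> dual_ball X"
    by blast
  let ?S = "X \<times> coords d ` dual_ball X"
  let ?F = "at (x0, coords d g) within ?S"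
  have g: "g \<in> dual X" using gb by (simp add: dual_ball_def)
  have "\<bar>eval_coords d u x - eval_coords d (coords d g) x0\<bar>
    \<le> norm (x - x0) + norm (u - coords d g) * norm x0"
    if "(x, u) \<in> ?S" for x u
  proof -
    from that obtain f where x: "x \<in> X" and fb: "f \<in> dual_ball X" and u: "u = coords d f" by auto
    then have f: "f \<in> dual X" by (simp add: dual_ball_def)
    have "\<bar>f (x - x0)\<bar> \<le> norm (x - x0)"
      using fb x x0 by (simp add: dual_ball_iff[OF X] subspace_diff[OF X])
    moreover have "\<bar>f x0 - g x0\<bar> \<le> norm (u - coords d g) * norm x0"
      using abs_le_dual_norm[OF X dual_minus[OF f g] x0]
      by (simp add: u norm_coords[OF dual_minus[OF f g], symmetric] coords_diff[OF f g])
    ultimately show ?thesis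
      using x x0 f g by (simp add: u eval_coords_coords dual_diff[OF X f])
  qed
  then have le: "\<forall>\<^sub>F z in ?F. norm ((case z of (x, u) \<Rightarrow> eval_coords d u x) - eval_coords d (coords d g) x0)
    \<le> norm (fst z - x0) + norm (snd z - coords d g) * norm x0"
    by (auto simp: eventually_at_filter intro!: always_eventually)
  have "((\<lambda>z. norm (fst z - x0) + norm (snd z - coords d g) * norm x0) \<longlongrightarrow>
    norm (fst (x0, coords d g) - x0) + norm (snd (x0, coords d g) - coords d g) * norm x0) ?F"
    by (intro tendsto_intros)
  then have "((\<lambda>z. norm (fst z - x0) + norm (snd z - coords d g) * norm x0) \<longlongrightarrow> 0) ?F"
    by simp
  from LIM_zero_cancel[OF Lim_null_comparison[OF le this]]
  show "((\<lambda>(x, u). eval_coords d u x) \<longlongrightarrow> (case z0 of (x, u) \<Rightarrow> eval_coords d u x))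
    (at z0 within ?S)" by (simp add: z0)
qed

text \<open>Evaluation inverts \<open>coords\<close>, and the value 0 off \<open>X\<close> matches
  the convention in \<open>dual\<close>, so the very functional is recovered. Distances follow from
  \<open>norm_coords\<close> applied to differences, which lie in \<open>dual X\<close>.\<close>

lemma isometry_onto_dual_ball_eval_coords:
  "isometry_onto_dual_ball (\<lambda>u x. if x \<in> X then eval_coords d u x else 0) (coords d ` dual_ball X) X"
proof -
  have eq: "(\<lambda>x. if x \<in> X then eval_coords d (coords d f) x else 0) = f" if "f \<in> dual_ball X" for f
    using that eval_coords_coords(1)[of f] by (auto simp: fun_eq_iff dual_ball_def dual_def)
  show ?thesis
    unfolding isometry_onto_dual_ball_def image_image
  proof (intro conjI ballI)
    show "(\<lambda>f x. if x \<in> X then eval_coords d (coords d f) x else 0) ` dual_ball X = dual_ball X"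
      using eq by (simp cong: image_cong_simp)
    fix u v assume "u \<in> coords d ` dual_ball X" "v \<in> coords d ` dual_ball X"
    then obtain f g where fg: "f \<in> dual_ball X" "g \<in> dual_ball X" "u = coords d f" "v = coords d g"
      by blast
    then have "f \<in> dual X" "g \<in> dual X" by (simp_all add: dual_ball_def)
    then have "dual_norm X (\<lambda>x. f x - g x) = dist u v"
      using norm_coords[OF dual_minus] by (simp add: fg coords_diff dist_norm)
    then show "dual_norm X (\<lambda>x. (if x \<in> X then eval_coords d u x else 0) -
      (if x \<in> X then eval_coords d v x else 0)) = dist u v"
      unfolding fg(3,4) eq[OF fg(1), THEN fun_cong] eq[OF fg(2), THEN fun_cong] .
  qed
qed

end

section \<open>Measurable dependence on the subspace\<close>

lemma space_effros_borel: "space effros_borel = SB"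
  by (simp add: effros_borel_def space_measure_of_conv)

lemma effros_borel_hit:
  assumes "open U"
  shows "{X \<in> SB. X \<inter> U \<noteq> {}} \<in> sets effros_borel"
proof -
  have "{{X \<in> SB. X \<inter> U \<noteq> {}} | U. open U} \<subseteq> Pow SB" by auto
  then show ?thesis
    unfolding effros_borel_def by (subst sets_measure_of) (use assms in auto)
qed

lemma borel_measurable_eval_bcontfun [measurable]:
  fixes f :: "'m \<Rightarrow> ('a::topological_space \<Rightarrow>\<^sub>C 'b::real_normed_vector)"
  assumes "f \<in> borel_measurable M"
  shows "(\<lambda>w. apply_bcontfun (f w) t) \<in> borel_measurable M"
  by (rule measurable_compose[OF assms borel_measurable_continuous_onI[OF continuous_on_eval_bcontfun]])

lemma borel_measurable_weight:
  fixes d :: "'m \<Rightarrow> nat \<Rightarrow> c_cantor"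
  assumes [measurable]: "\<And>n. (\<lambda>w. d w n) \<in> borel_measurable M"
  shows "(\<lambda>w. weight (d w) n) \<in> borel_measurable M"
  unfolding weight_def
  by (intro borel_measurable_max borel_measurable_const borel_measurable_norm_c_cantor) measurable

lemma borel_measurable_defect:
  fixes d :: "'m \<Rightarrow> nat \<Rightarrow> c_cantor"
  assumes [measurable]: "\<And>n. (\<lambda>w. d w n) \<in> borel_measurable M"
  shows "(\<lambda>w. defect (d w) j u) \<in> borel_measurable M"
proof -
  obtain p n m l where j: "j = (p, n, m, l)" by (cases j)
  note [measurable] = borel_measurable_weight[of d, OF assms]
  have [measurable]: "(\<lambda>w. norm (of_rat p *\<^sub>R d w n + d w m - d w l)) \<in> borel_measurable M"
    by (intro borel_measurable_norm_c_cantor)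
      (simp add: plus_bcontfun.rep_eq minus_bcontfun.rep_eq scaleR_bcontfun.rep_eq)
  show ?thesis unfolding j defect_def prod.case by measurable
qed

lemma measurable_approx_index:
  fixes d :: "'m \<Rightarrow> nat \<Rightarrow> c_cantor"
  assumes [measurable]: "\<And>n. (\<lambda>w. d w n) \<in> borel_measurable M" "x \<in> borel_measurable M"
  shows "(\<lambda>w. approx_index (d w) (x w) k) \<in> measurable M (count_space UNIV)"
proof -
  have [measurable]: "(\<lambda>w. dist (x w) (d w n)) \<in> borel_measurable M" for n
    unfolding dist_norm by (intro borel_measurable_norm_c_cantor) (simp add: minus_bcontfun.rep_eq)
  show ?thesis unfolding approx_index_def by measurable
qed

text \<open>Carried to the cube, \<open>C\<close> becomes compact, and meeting it means that some
  point of it has no positive defect; \<open>from_nat\<close> enumerates the defects so that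
  \<open>sets_ex_compact_all_nonpos\<close> applies.\<close>

lemma dense_sequence_hit:
  fixes d :: "c_cantor set \<Rightarrow> nat \<Rightarrow> c_cantor"
  assumes d: "\<And>n. (\<lambda>X. d X n) \<in> borel_measurable effros_borel"
    and dense: "\<And>X. X \<in> SB \<Longrightarrow> dense_sequence X (d X)"
    and C: "closedin ball_l_infty C"
  shows "{X \<in> space effros_borel. coords (d X) ` dual_ball X \<inter> C \<noteq> {}} \<in> sets effros_borel"
proof -
  have "C \<subseteq> cball 0 1"
    using closedin_subset[OF C] by (simp add: ball_l_infty_def topspace_weak_star)
  have "homeomorphic_map ball_l_infty (top_of_set unit_cube) apply_bcontfun"
    using homeomorphic_maps_ball_l_infty homeomorphic_maps_map by blast
  then have "closedin (top_of_set unit_cube) (apply_bcontfun ` C)"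
    using C closedin_subset[OF C] homeomorphic_map_closedness_eq by blast
  then have "compact (apply_bcontfun ` C)"
    using closedin_compact compact_unit_cube by blast
  then have "{X \<in> space effros_borel. \<exists>u\<in>apply_bcontfun ` C. \<forall>k. defect (d X) (from_nat k) u \<le> 0}
    \<in> sets effros_borel"
    by (rule sets_ex_compact_all_nonpos)
      (auto intro: continuous_on_subset[OF continuous_on_defect] borel_measurable_defect d)
  moreover have "(\<exists>u\<in>apply_bcontfun ` C. \<forall>k. defect (d X) (from_nat k) u \<le> 0) \<longleftrightarrow>
    coords (d X) ` dual_ball X \<inter> C \<noteq> {}" if "X \<in> space effros_borel" for X
  proof -
    interpret dense_sequence X "d X" using dense that by (simp add: space_effros_borel)
    have all: "(\<forall>k. defect (d X) (from_nat k) u \<le> 0) \<longleftrightarrow> (\<forall>j. defect (d X) j u \<le> 0)" for u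
    proof (intro iffI allI)
      fix j :: "rat \<times> nat \<times> nat \<times> nat"
      assume "\<forall>k. defect (d X) (from_nat k) u \<le> 0"
      from spec[OF this, of "to_nat j"] show "defect (d X) j u \<le> 0" by simp
    qed blast
    show ?thesis
      using \<open>C \<subseteq> cball 0 1\<close> unfolding coords_dual_ball bex_simps all by blast
  qed
  ultimately show ?thesis by (simp cong: conj_cong)
qed

theorem theorem3:
  shows "\<exists>\<Theta> :: c_cantor set \<Rightarrow> l_infty set.
    \<Theta> \<in> effros_borel \<rightarrow>\<^sub>M borel_of (vietoris ball_l_infty) \<and>
    (\<forall>X\<in>SB. \<exists>T. dual_linear_isometry T X (closure (span (\<Theta> X))) \<and> T ` dual_ball X = \<Theta> X) \<and>
    (\<exists>pairing :: c_cantor set \<times> c_cantor \<times> l_infty \<Rightarrow> real.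
      pairing \<in> pairing_borel \<Theta> \<rightarrow>\<^sub>M borel \<and>
      (\<forall>X\<in>SB.
        continuous_on (X \<times> \<Theta> X) (\<lambda>(x, u). pairing (X, x, u)) \<and>
        isometry_onto_dual_ball (\<lambda>u x. if x \<in> X then pairing (X, x, u) else 0) (\<Theta> X) X))"
proof -
  obtain y :: "nat \<Rightarrow> c_cantor" where y: "closure (range y) = UNIV"
    using ex_dense_sequence_c_cantor by blast
  obtain s :: "nat \<Rightarrow> c_cantor set \<Rightarrow> c_cantor"
    where s: "\<And>n. s n \<in> borel_measurable effros_borel"
      and closure_s: "\<And>X. X \<in> space effros_borel \<Longrightarrow> closure (range (\<lambda>n. s n X)) = X"
  \<comment> \<open>The set-valued map is the identity on \<open>SB\<close>: its hitting sets for
    open \<open>U\<close> are the generators of the Effros-Borel structure.\<close>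
  proof (rule Castaing_representation[OF complete_bcontfun y, of effros_borel "\<lambda>X. X"])
    fix X assume "X \<in> space effros_borel"
    then have "X \<in> SB" by (simp add: space_effros_borel)
    then show "closed X" "X \<noteq> {}" using subspace_0[of X] by (auto simp: SB_def)
  next
    fix U :: "c_cantor set" assume "open U"
    then show "{X \<in> space effros_borel. X \<inter> U \<noteq> {}} \<in> sets effros_borel"
      unfolding space_effros_borel by (rule effros_borel_hit)
  qed (rule that)
  define d where "d X n = s n X" for X n
  have d [measurable]: "(\<lambda>X. d X n) \<in> borel_measurable effros_borel" for n
    using s[of n] by (simp add: d_def)
  have dense: "dense_sequence X (d X)" if "X \<in> SB" for X
    using that closure_s[of X] by (simp add: space_effros_borel dense_sequence_def d_def[abs_def] SB_def)
  define \<Theta> where "\<Theta> X = coords (d X) ` dual_ball X" for X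
  define pairing where "pairing = (\<lambda>(X, x, u). eval_coords (d X) u x)"
  have "\<Theta> \<in> effros_borel \<rightarrow>\<^sub>M borel_of (vietoris ball_l_infty)"
    unfolding \<Theta>_def
    by (intro measurable_vietoris second_countable_ball_l_infty metrizable_space_ball_l_infty
        dense_sequence_hit dense_sequence.compactin_coords_dual_ball d dense)
      (simp_all add: space_effros_borel)
  moreover have "\<exists>T. dual_linear_isometry T X (closure (span (\<Theta> X))) \<and> T ` dual_ball X = \<Theta> X"
    if "X \<in> SB" for X
    using dense_sequence.dual_linear_isometry_coords[OF dense[OF that]] unfolding \<Theta>_def by blast
  moreover have "continuous_on (X \<times> \<Theta> X) (\<lambda>(x, u). pairing (X, x, u))"
    "isometry_onto_dual_ball (\<lambda>u x. if x \<in> X then pairing (X, x, u) else 0) (\<Theta> X) X"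
    if "X \<in> SB" for X
    unfolding \<Theta>_def pairing_def prod.case
    by (rule dense_sequence.continuous_on_eval_coords[OF dense[OF that]],
        rule dense_sequence.isometry_onto_dual_ball_eval_coords[OF dense[OF that]])
  moreover have "pairing \<in> pairing_borel \<Theta> \<rightarrow>\<^sub>M borel"
  proof -
    \<comment> \<open>The approximating terms are measurable on the whole product; only their
      convergence needs the restriction to \<open>pairing_domain \<Theta>\<close>.\<close>
    define N where "N = effros_borel \<Otimes>\<^sub>M (borel :: c_cantor measure) \<Otimes>\<^sub>M borel_of ball_l_infty"
    define a where "a k z = approx_index (d (fst z)) (fst (snd z)) k"
      for k and z :: "c_cantor set \<times> c_cantor \<times> l_infty"
    have dN: "(\<lambda>z. d (fst z) n) \<in> borel_measurable N" for n
      unfolding N_def by measurable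
    have "(\<lambda>z. fst (snd z)) \<in> borel_measurable N"
      unfolding N_def by measurable
    with dN have a: "a k \<in> measurable N (count_space UNIV)" for k
      unfolding a_def by (rule measurable_approx_index)
    have "continuous_map ball_l_infty euclidean (\<lambda>u. apply_bcontfun u n)" for n
      unfolding ball_l_infty_def
      by (rule continuous_map_from_subtopology[OF continuous_map_weak_star_coordinate])
    from measurable_borel_of_continuous_map[OF this]
    have [measurable]: "(\<lambda>z. apply_bcontfun (snd (snd z)) n) \<in> borel_measurable N" for n
      unfolding N_def by measurable
    note [measurable] = borel_measurable_weight[OF dN]
    have "(\<lambda>z. weight (d (fst z)) n * apply_bcontfun (snd (snd z)) n) \<in> borel_measurable N" for n
      by measurable
    \<comment> \<open>The index \<open>a k z\<close> varies with \<open>z\<close> but takes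
      countably many values, so it may replace the fixed \<open>n\<close>.\<close>
    from measurable_compose_countable[OF this a]
    have term_meas: "(\<lambda>z. weight (d (fst z)) (a k z) * apply_bcontfun (snd (snd z)) (a k z))
      \<in> borel_measurable N" for k .
    show ?thesis
    proof (rule borel_measurable_LIMSEQ_metric)
      show "(\<lambda>z. weight (d (fst z)) (a k z) * apply_bcontfun (snd (snd z)) (a k z))
        \<in> borel_measurable (pairing_borel \<Theta>)" for k
        using measurable_restrict_space1[OF term_meas[of k], of "pairing_domain \<Theta>"]
        by (simp add: pairing_borel_def N_def)
      fix z assume "z \<in> space (pairing_borel \<Theta>)"
      then have "z \<in> pairing_domain \<Theta>" by (simp add: pairing_borel_def space_restrict_space)
      then obtain X x f where z: "z = (X, x, coords (d X) f)" and X: "X \<in> SB" and x: "x \<in> X"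
        and f: "f \<in> dual_ball X"
        by (auto simp: pairing_domain_def \<Theta>_def)
      have "f \<in> dual X" using f by (simp add: dual_ball_def)
      from dense_sequence.eval_coords_coords[OF dense[OF X] this x]
      show "(\<lambda>k. weight (d (fst z)) (a k z) * apply_bcontfun (snd (snd z)) (a k z)) \<longlonglongrightarrow> pairing z"
        by (simp add: z a_def pairing_def)
    qed
  qed
  ultimately show ?thesis by (intro exI[of _ \<Theta>] exI[of _ pairing] conjI ballI)
qed

end
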